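(* For every prime power $q\geqslant 7$ with $q\equiv 3\pmod 4$, there exists a Neumaier graph of coherent rank five with parameters \[ (v,k,\lambda;e,s)=\left((q+1)q(q-2),\ \frac{(q+1)^2(q-2)}{2},\ \frac{(q+1)(q^2+q-8)}{4};\ \frac{(q-1)^2}{2},\ q(q-2)\right). \]
   Context: All graphs are finite and simple. A graph is $(v,k,\lambda)$-edge-regular if it has $v$ vertices, is $k$-regular, and every adjacent pair of vertices has exactly $\lambda$ common neighbours. A proper non-empty clique $C$ (proper subset of the vertex set) of order $s$ is $e$-regular if every vertex outside $C$ is adjacent to precisely $e>0$ vertices in $C$. A Neumaier graph is a non-complete edge-regular graph containing an $e$-regular clique; it has parameters $(v,k,\lambda;e,s)$ if it is $(v,k,\lambda)$-edge-regular and contains an $e$-regular clique of order $s$. Let $X$ be a finite set. A coherent algebra on $X$ is a real vector subspace $\mathcal C\subseteq\mathbb R^{X\times X}$ such that (1) the identity matrix $I$ and the all-ones matrix $J$ lie in $\mathcal C$; (2) $M^{T}\in\mathcal C$ for every $M\in\mathcal C$; (3) for all $M,N\in\mathcal C$ both the matrix product $MN$ and the entrywise product $M\circ N$ lie in $\mathcal C$. For a graph $\Gamma$ on vertex set $X$ with adjacency matrix $A_\Gamma$, the coherent closure of $\Gamma$ is the smallest coherent algebra on $X$ containing $A_\Gamma$, and the coherent rank of $\Gamma$ is the dimension of its coherent closure as a real vector space. *)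

theory Defs
  imports
    Complex_Main
    "HOL-Library.Function_Algebras"
    "HOL-Number_Theory.Prime_Powers"
    "Graph_Theory.Pair_Digraph"
    "Graph_Theory.Kuratowski"
begin

section \<open>Neumaier graphs\<close>

text \<open>A finite simple graph is a \<open>pair_graph\<close>: finite vertex set \<open>pverts G\<close>, and a symmetric
  loop-free set of arcs \<open>parcs G\<close>, so that each edge is represented by both of its orientations.\<close>

definition neighbours :: "'a pair_pre_digraph \<Rightarrow> 'a \<Rightarrow> 'a set" where
  "neighbours G x = {y \<in> pverts G. (x, y) \<in> parcs G}"

definition edge_regular :: "'a pair_pre_digraph \<Rightarrow> nat \<Rightarrow> nat \<Rightarrow> nat \<Rightarrow> bool" where
  "edge_regular G v k l \<longleftrightarrow>
     pair_graph G \<and> card (pverts G) = v \<and>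
     (\<forall>x\<in>pverts G. card (neighbours G x) = k) \<and>
     (\<forall>x\<in>pverts G. \<forall>y\<in>pverts G. (x, y) \<in> parcs G \<longrightarrow>
        card (neighbours G x \<inter> neighbours G y) = l)"

definition clique :: "'a pair_pre_digraph \<Rightarrow> 'a set \<Rightarrow> bool" where
  "clique G C \<longleftrightarrow> C \<subseteq> pverts G \<and> (\<forall>x\<in>C. \<forall>y\<in>C. x \<noteq> y \<longrightarrow> (x, y) \<in> parcs G)"

definition regular_clique :: "'a pair_pre_digraph \<Rightarrow> nat \<Rightarrow> 'a set \<Rightarrow> bool" where
  "regular_clique G e C \<longleftrightarrow>
     clique G C \<and> C \<noteq> {} \<and> C \<noteq> pverts G \<and> e > 0 \<and>
     (\<forall>x\<in>pverts G - C. card (neighbours G x \<inter> C) = e)"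

definition neumaier_graph ::
    "'a pair_pre_digraph \<Rightarrow> nat \<Rightarrow> nat \<Rightarrow> nat \<Rightarrow> nat \<Rightarrow> nat \<Rightarrow> bool" where
  "neumaier_graph G v k l e s \<longleftrightarrow>
     edge_regular G v k l \<and> \<not> complete_digraph v (with_proj G) \<and>
     (\<exists>C. regular_clique G e C \<and> card C = s)"

section \<open>Coherent algebras\<close>

text \<open>Real matrices with rows and columns indexed by \<open>X\<close> are represented by the functions
  \<open>'a \<Rightarrow> 'a \<Rightarrow> real\<close> vanishing off \<open>X \<times> X\<close>. Addition and the zero matrix are those of
  \<open>Function_Algebras\<close>.\<close>

type_synonym 'a rmat = "'a \<Rightarrow> 'a \<Rightarrow> real"

definition mats_on :: "'a set \<Rightarrow> 'a rmat set" where
  "mats_on X = {M. \<forall>x y. (x, y) \<notin> X \<times> X \<longrightarrow> M x y = 0}"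

definition scale_mat :: "real \<Rightarrow> 'a rmat \<Rightarrow> 'a rmat" where
  "scale_mat c M = (\<lambda>x y. c * M x y)"

global_interpretation rmat: vector_space scale_mat
  by unfold_locales (auto simp: scale_mat_def fun_eq_iff algebra_simps)

definition id_mat :: "'a set \<Rightarrow> 'a rmat" where
  "id_mat X = (\<lambda>x y. if x \<in> X \<and> x = y then 1 else 0)"

definition ones_mat :: "'a set \<Rightarrow> 'a rmat" where
  "ones_mat X = (\<lambda>x y. if x \<in> X \<and> y \<in> X then 1 else 0)"

definition transp_mat :: "'a rmat \<Rightarrow> 'a rmat" where
  "transp_mat M = (\<lambda>x y. M y x)"

definition mult_mat :: "'a set \<Rightarrow> 'a rmat \<Rightarrow> 'a rmat \<Rightarrow> 'a rmat" where
  "mult_mat X M N = (\<lambda>x y. \<Sum>z\<in>X. M x z * N z y)"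

definition entrywise_mult :: "'a rmat \<Rightarrow> 'a rmat \<Rightarrow> 'a rmat" where
  "entrywise_mult M N = (\<lambda>x y. M x y * N x y)"

definition coherent_algebra :: "'a set \<Rightarrow> 'a rmat set \<Rightarrow> bool" where
  "coherent_algebra X \<C> \<longleftrightarrow>
     \<C> \<subseteq> mats_on X \<and> rmat.subspace \<C> \<and>
     id_mat X \<in> \<C> \<and> ones_mat X \<in> \<C> \<and>
     (\<forall>M\<in>\<C>. transp_mat M \<in> \<C>) \<and>
     (\<forall>M\<in>\<C>. \<forall>N\<in>\<C>. mult_mat X M N \<in> \<C> \<and> entrywise_mult M N \<in> \<C>)"

definition adj_mat :: "'a pair_pre_digraph \<Rightarrow> 'a rmat" where
  "adj_mat G = (\<lambda>x y. if (x, y) \<in> parcs G then 1 else 0)"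

definition coherent_closure :: "'a pair_pre_digraph \<Rightarrow> 'a rmat set" where
  "coherent_closure G = \<Inter>{\<C>. coherent_algebra (pverts G) \<C> \<and> adj_mat G \<in> \<C>}"

definition coherent_rank :: "'a pair_pre_digraph \<Rightarrow> nat" where
  "coherent_rank G = rmat.dim (coherent_closure G)"

text \<open>The intersection above is indeed the smallest coherent algebra containing the adjacency
  matrix.\<close>

lemma coherent_algebra_mats_on: "coherent_algebra X (mats_on X)"
  unfolding coherent_algebra_def rmat.subspace_def
  by (auto simp: mats_on_def id_mat_def ones_mat_def transp_mat_def mult_mat_def
        entrywise_mult_def scale_mat_def intro!: sum.neutral)

lemma coherent_closure_least:
  assumes "pair_graph G"
  shows "coherent_algebra (pverts G) (coherent_closure G)"
    and "adj_mat G \<in> coherent_closure G"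
    and "\<And>\<C>. coherent_algebra (pverts G) \<C> \<Longrightarrow> adj_mat G \<in> \<C> \<Longrightarrow> coherent_closure G \<subseteq> \<C>"
proof -
  interpret pair_graph G by fact
  have "adj_mat G \<in> mats_on (pverts G)"
    by (auto simp: adj_mat_def mats_on_def dest: in_arcsD1 in_arcsD2)
  with coherent_algebra_mats_on[of "pverts G"]
  have sub: "coherent_closure G \<subseteq> mats_on (pverts G)"
    by (auto simp: coherent_closure_def)
  have "rmat.subspace (coherent_closure G)"
    unfolding coherent_closure_def
    by (rule rmat.subspace_Inter) (auto simp: coherent_algebra_def)
  with sub show "coherent_algebra (pverts G) (coherent_closure G)"
    unfolding coherent_algebra_def
    by (auto simp: coherent_closure_def coherent_algebra_def)
qed (auto simp: coherent_closure_def)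

text \<open>For \<open>q \<ge> 7\<close> and \<open>q mod 4 = 3\<close>, the parameter formulas over the natural numbers agree with
  the rational ones: no subtraction truncates and every division is exact.\<close>

lemma parameters_exact:
  fixes q :: nat
  assumes "q \<ge> 7" and "q mod 4 = 3"
  shows "real ((q + 1) * q * (q - 2)) = (real q + 1) * real q * (real q - 2)"
    and "real ((q + 1)\<^sup>2 * (q - 2) div 2) = (real q + 1)\<^sup>2 * (real q - 2) / 2"
    and "real ((q + 1) * (q\<^sup>2 + q - 8) div 4) = (real q + 1) * ((real q)\<^sup>2 + real q - 8) / 4"
    and "real ((q - 1)\<^sup>2 div 2) = (real q - 1)\<^sup>2 / 2"
    and "real (q * (q - 2)) = real q * (real q - 2)"
proof -
  have dvd4: "4 dvd q + 1" using assms(2) by presburger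
  then have dvd2: "2 dvd q + 1" "2 dvd q - 1" using assms(2) by presburger+
  have d4: "4 dvd (q + 1) * (q\<^sup>2 + q - 8)" using dvd4 by (rule dvd_mult2)
  have d2: "2 dvd (q + 1)\<^sup>2 * (q - 2)" and d1: "2 dvd (q - 1)\<^sup>2"
    using dvd2 by (simp_all only: power2_eq_square dvd_mult dvd_mult2)
  have "q\<^sup>2 \<ge> 7 * q" using assms(1) by (simp add: power2_eq_square)
  then have ge: "q\<^sup>2 + q \<ge> 8" using assms(1) by linarith
  show "real ((q + 1)\<^sup>2 * (q - 2) div 2) = (real q + 1)\<^sup>2 * (real q - 2) / 2"
    unfolding real_of_nat_div[OF d2] using assms(1) by (simp add: of_nat_diff add.commute)
  show "real ((q + 1) * (q\<^sup>2 + q - 8) div 4) = (real q + 1) * ((real q)\<^sup>2 + real q - 8) / 4"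
    unfolding real_of_nat_div[OF d4] of_nat_mult of_nat_diff[OF ge] by simp
  show "real ((q - 1)\<^sup>2 div 2) = (real q - 1)\<^sup>2 / 2"
    unfolding real_of_nat_div[OF d1] using assms(1) by (simp add: of_nat_diff)
  have "real (q - 2) = real q - 2" using assms(1) by (simp add: of_nat_diff)
  then show "real ((q + 1) * q * (q - 2)) = (real q + 1) * real q * (real q - 2)"
    and "real (q * (q - 2)) = real q * (real q - 2)"
    by (simp_all only: of_nat_mult of_nat_add of_nat_1)
qed

end

theory Submission
  imports Defs "HOL-Algebra.Algebra" "HOL-Number_Theory.Residues"
begin

text \<open>
  Let \<open>F\<close> be a field of order \<open>q\<close>, let \<open>T \<subseteq> F\<close> have \<open>q - 2\<close> elements, and let \<open>h\<^sub>m\<close> (\<open>m \<in> F\<close>) be the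
  nonconstant rows of the Paley Hadamard matrix of order \<open>q + 1\<close>, whose columns are indexed by
  \<open>U = F \<union> {\<infinity>}\<close>. A vertex is a point \<open>(t, f) \<in> T \<times> F\<close> of the affine plane together with some \<open>u \<in> U\<close>.
  Vertices over the same point are not adjacent, vertices over distinct points with the same
  first coordinate are adjacent, and vertices \<open>u\<close>, \<open>u'\<close> over two points on a line of slope \<open>m\<close> are
  adjacent iff \<open>h\<^sub>m(u) = h\<^sub>m(u')\<close>. The vertices with a fixed \<open>u\<close> form a regular clique.

  Let \<open>S\<close> be the signed matrix with blocks \<open>h\<^sub>m h\<^sub>m\<^sup>T\<close> between points joined by a line of slope \<open>m\<close>.
  By orthogonality of the rows, a third point \<open>Z\<close> contributes to the block of \<open>S\<^sup>2\<close> at \<open>(X, Y)\<close> only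
  if it is collinear with \<open>X\<close> and \<open>Y\<close>. Hence \<open>S\<^sup>2\<close> is a combination of \<open>I\<close>, \<open>S\<close> and the matrix \<open>P\<close> of
  ``same point'', and together with the matrix \<open>Q\<close> of ``same first coordinate'' and with \<open>J\<close> these span
  a coherent algebra of dimension five. The choice \<open>|T| = q - 2\<close> is what makes the two kinds
  of edges have equally many common neighbours. Finally, the numbers of common neighbours of the two kinds
  of non-adjacent pairs differ, so the algebra generated by the adjacency matrix \<open>A\<close> contains \<open>P\<close>,
  and then \<open>Q\<close> by means of \<open>A P\<close>.
\<close>

section \<open>Finite fields\<close>

text \<open>By Pascal's rule every coefficient of the next power splits in two. One half collects to
  the old sum times \<open>x\<close>; the other, after an index shift that absorbs the term
  \<open>y [^] Suc n\<close>, to the old sum times \<open>y\<close>. Integer coefficients are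
  written as \<open>add_pow\<close>.\<close>

lemma (in cring) binomial:
  assumes [simp]: "x \<in> carrier R" "y \<in> carrier R"
  shows "(x \<oplus> y) [^] (n::nat) = (\<Oplus>k\<in>{..n}. add_pow R (n choose k) (x [^] k \<otimes> y [^] (n - k)))"
proof (induction n)
  case 0
  then show ?case by simp
next
  case (Suc n)
  let ?t = "\<lambda>m k. add_pow R (m choose k) (x [^] k \<otimes> y [^] (m - k))"
  have "(\<Oplus>k\<in>{..Suc n}. ?t (Suc n) k)
      = (\<Oplus>k\<in>{..n}. ?t (Suc n) (Suc k)) \<oplus> y [^] Suc n"
    by (subst finsum_Suc2) simp_all
  also have "(\<Oplus>k\<in>{..n}. ?t (Suc n) (Suc k))
      = (\<Oplus>k\<in>{..n}. add_pow R (n choose k) (x [^] Suc k \<otimes> y [^] (n - k))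
          \<oplus> add_pow R (n choose Suc k) (x [^] Suc k \<otimes> y [^] (n - k)))"
    by (intro finsum_cong' refl) (simp_all del: nat_pow_Suc add: add.nat_pow_mult)
  also have "\<dots> = (\<Oplus>k\<in>{..n}. add_pow R (n choose k) (x [^] Suc k \<otimes> y [^] (n - k)))
      \<oplus> (\<Oplus>k\<in>{..n}. add_pow R (n choose Suc k) (x [^] Suc k \<otimes> y [^] (n - k)))"
    by (rule finsum_addf) auto
  also have "(\<Oplus>k\<in>{..n}. add_pow R (n choose k) (x [^] Suc k \<otimes> y [^] (n - k)))
      = (\<Oplus>k\<in>{..n}. ?t n k \<otimes> x)"
    by (intro finsum_cong' refl) (simp_all add: add_pow_ldistr add_pow_rdistr m_ac)
  also have "\<dots> = (\<Oplus>k\<in>{..n}. ?t n k) \<otimes> x"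
    by (rule finsum_ldistr[symmetric]) auto
  also have "(\<Oplus>k\<in>{..n}. ?t n k) \<otimes> x \<oplus>
        (\<Oplus>k\<in>{..n}. add_pow R (n choose Suc k) (x [^] Suc k \<otimes> y [^] (n - k))) \<oplus> y [^] Suc n
      = (\<Oplus>k\<in>{..n}. ?t n k) \<otimes> x \<oplus>
        ((\<Oplus>k\<in>{..n}. add_pow R (n choose Suc k) (x [^] Suc k \<otimes> y [^] (n - k))) \<oplus> y [^] Suc n)"
    by (rule a_assoc) (auto intro: finsum_closed)
  also have "(\<Oplus>k\<in>{..n}. add_pow R (n choose Suc k) (x [^] Suc k \<otimes> y [^] (n - k))) \<oplus> y [^] Suc n
      = (\<Oplus>k\<in>{..Suc n}. add_pow R (n choose k) (x [^] k \<otimes> y [^] (Suc n - k)))"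
    by (subst finsum_Suc2) simp_all
  also have "\<dots> = (\<Oplus>k\<in>{..n}. add_pow R (n choose k) (x [^] k \<otimes> y [^] (Suc n - k)))"
    by (subst finsum_Suc) (simp_all add: binomial_eq_0)
  also have "\<dots> = (\<Oplus>k\<in>{..n}. ?t n k \<otimes> y)"
    by (intro finsum_cong' refl) (simp_all add: add_pow_ldistr m_assoc Suc_diff_le)
  also have "\<dots> = (\<Oplus>k\<in>{..n}. ?t n k) \<otimes> y"
    by (rule finsum_ldistr[symmetric]) auto
  finally show ?case
    using Suc by (simp add: r_distr[symmetric] finsum_closed)
qed

lemma (in cring) add_pow_eq_zero_if_char_dvd:
  assumes "add_pow R p \<one> = \<zero>" and "p dvd (n::nat)" and [simp]: "x \<in> carrier R"
  shows "add_pow R n x = \<zero>"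
proof -
  obtain m where m: "n = p * m" using assms(2) by blast
  have "add_pow R n x = (add_pow R n \<one>) \<otimes> x" by (simp add: add_pow_ldistr)
  also have "add_pow R n \<one> = add_pow R m (add_pow R p \<one>)" by (simp add: m add.nat_pow_pow)
  finally show ?thesis by (simp add: assms(1))
qed

text \<open>Only the two extreme binomial terms survive, because \<open>p\<close> divides
  \<open>p choose k\<close> for \<open>0 < k < p\<close>. Working in a commutative ring covers both
  a field and its polynomial ring.\<close>

lemma (in cring) frobenius_add:
  assumes p: "Factorial_Ring.prime (p::nat)" and ch: "add_pow R p \<one> = \<zero>" and [simp]: "x \<in> carrier R" "y \<in> carrier R"
  shows "(x \<oplus> y) [^] (p::nat) = x [^] p \<oplus> y [^] p"
proof -
  obtain m where m: "p = Suc m" "m > 0" using prime_gt_1_nat[OF p] by (cases p) auto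
  let ?t = "\<lambda>k. add_pow R (p choose k) (x [^] k \<otimes> y [^] (p - k))"
  have "(x \<oplus> y) [^] p = (\<Oplus>k\<in>{..Suc m}. ?t k)" using binomial[of x y p] by (simp add: m)
  also have "\<dots> = ?t (Suc m) \<oplus> (\<Oplus>k\<in>{..m}. ?t k)" by (subst finsum_Suc) auto
  also have "(\<Oplus>k\<in>{..m}. ?t k) = (\<Oplus>k\<in>{..m}. if k = 0 then y [^] p else \<zero>)"
  proof (intro finsum_cong' refl)
    fix k assume "k \<in> {..m}"
    then show "?t k = (if k = 0 then y [^] p else \<zero>)"
      using dvd_choose_prime[of k p] p m
      by (auto intro!: add_pow_eq_zero_if_char_dvd[OF ch])
  qed auto
  also have "\<dots> = y [^] p"
    using add.finprod_singleton[of 0 "{..m}" "\<lambda>_. y [^] p"] by (simp add: eq_commute cong: if_cong)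
  finally show ?thesis by (simp add: m)
qed

lemma (in cring) frobenius_iter_add:
  assumes p: "Factorial_Ring.prime (p::nat)" and ch: "add_pow R p \<one> = \<zero>" and [simp]: "x \<in> carrier R" "y \<in> carrier R"
  shows "(x \<oplus> y) [^] ((p::nat) ^ n) = x [^] (p ^ n) \<oplus> y [^] (p ^ n)"
proof (induction n)
  case (Suc n)
  have "(x \<oplus> y) [^] (p ^ Suc n) = ((x \<oplus> y) [^] (p ^ n)) [^] p"
    by (simp add: nat_pow_pow mult.commute)
  also have "\<dots> = (x [^] (p ^ n)) [^] p \<oplus> (y [^] (p ^ n)) [^] p"
    using Suc frobenius_add[OF p ch] by simp
  finally show ?case by (simp add: nat_pow_pow mult.commute)
qed simp

section \<open>Finite fields as fixed points of Frobenius iterates\<close>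

lemma ring_hom_add_pow:
  assumes "h \<in> ring_hom R S" "ring R" "ring S" "x \<in> carrier R"
  shows "h (add_pow R (n::nat) x) = add_pow S n (h x)"
proof -
  interpret R: ring R by fact
  interpret S: ring S by fact
  interpret ring_hom_ring R S h using assms by (intro ring_hom_ringI2) auto
  show ?thesis using assms(4) by (induction n) auto
qed

text \<open>The roots of \<open>X\<^sup>q - X\<close> are simple because it equals \<open>(X - a)\<^sup>q - (X - a)\<close> for every root \<open>a\<close>.\<close>

lemma (in algebraically_closed) roots_of_frobenius_iterate:
  assumes p: "Factorial_Ring.prime (p::nat)" and ch: "add_pow L p \<one> = \<zero>" and n: "n > 0"
  defines "K \<equiv> {x \<in> carrier L. x [^] (p ^ n) = x}"
  shows "finite K" "card K = p ^ n"
proof -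
  define q where "q = p ^ n"
  have q: "q > 1" using prime_gt_1_nat[OF p] n by (simp add: q_def one_less_power del: One_nat_def)
  let ?U = "poly_ring L"
  interpret U: domain ?U by (rule univ_poly_is_domain[OF carrier_is_subring])
  have X[simp]: "X \<in> carrier ?U" by (rule var_closed(1)[OF carrier_is_subring])
  have one_U: "\<one>\<^bsub>?U\<^esub> = [\<one>]" by (simp add: univ_poly_one)
  have hom: "poly_of_const \<in> ring_hom L ?U"
    using canonical_embedding_is_hom[OF carrier_is_subring] by simp
  have "add_pow ?U p \<one>\<^bsub>?U\<^esub> = poly_of_const (add_pow L p \<one>)"
    using ring_hom_add_pow[OF hom ring_axioms U.ring_axioms one_closed] ring_hom_one[OF hom] by simp
  also have "\<dots> = \<zero>\<^bsub>?U\<^esub>"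
    using ring_hom_zero[OF hom ring_axioms U.ring_axioms] by (simp add: ch)
  finally have chU: "add_pow ?U p \<one>\<^bsub>?U\<^esub> = \<zero>\<^bsub>?U\<^esub>" .
  define f where "f = X [^]\<^bsub>?U\<^esub> q \<ominus>\<^bsub>?U\<^esub> X"
  have f[simp]: "f \<in> carrier ?U" by (simp add: f_def)
  have eval_f: "eval f a = a [^] q \<ominus> a" if "a \<in> carrier L" for a
  proof -
    interpret E: ring_hom_cring ?U L "\<lambda>p. eval p a"
      by (rule eval_cring_hom[OF carrier_is_subring that])
    show ?thesis by (simp add: f_def a_minus_def eval_var that)
  qed
  have degX: "degree (X [^]\<^bsub>?U\<^esub> q) = q"
    unfolding unitary_monom_eq_var_pow[OF carrier_is_subring, symmetric] by (simp add: monom_def)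
  have deg_mX: "degree (\<ominus>\<^bsub>?U\<^esub> X) = 1"
    by (subst univ_poly_a_inv_degree[OF carrier_is_subring X]) (simp add: var_def)
  have degf: "degree f = q"
    unfolding f_def a_minus_def univ_poly_add
    by (subst poly_add_degree_eq[OF carrier_is_subring])
       (use q degX deg_mX in \<open>simp_all add: univ_poly_carrier\<close>)
  then have f0: "f \<noteq> []" using q by auto
  have root_iff: "is_root f a \<longleftrightarrow> a \<in> K" for a
    using f0 by (auto simp: is_root_def eval_f K_def q_def)
  have simple: "alg_mult f a \<le> 1" if a: "a \<in> carrier L" for a
  proof (rule ccontr)
    assume "\<not> alg_mult f a \<le> 1"
    then have le: "2 \<le> alg_mult f a" by simp
    have "alg_mult f a > 0" using le by simp
    then have aK: "a [^] q = a"
      using alg_mult_gt_zero_iff_is_root[OF f] root_iff by (auto simp: K_def q_def)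
    let ?c = "poly_of_const a" and ?l = "[\<one>, \<ominus> a]"
    have c[simp]: "?c \<in> carrier ?U" using hom a by (auto simp: ring_hom_def)
    have l[simp]: "?l \<in> carrier ?U"
      using a by (simp add: univ_poly_carrier[symmetric] polynomial_def)
    have cl: "X = ?l \<oplus>\<^bsub>?U\<^esub> ?c"
      using a by (auto simp: univ_poly_add poly_of_const_def var_def l_neg)
    have cq: "?c [^]\<^bsub>?U\<^esub> q = ?c"
    proof -
      interpret H: ring_hom_cring L ?U poly_of_const
        using hom by (intro ring_hom_cring.intro ring_hom_cring_axioms.intro is_cring U.is_cring)
      show ?thesis using H.hom_pow[of a q] a by (simp add: aK)
    qed
    have "X [^]\<^bsub>?U\<^esub> q = ?l [^]\<^bsub>?U\<^esub> q \<oplus>\<^bsub>?U\<^esub> ?c"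
      unfolding cl q_def using U.frobenius_iter_add[OF p chU l c, of n] cq
      by (simp add: q_def)
    then have "f = ?l [^]\<^bsub>?U\<^esub> q \<oplus>\<^bsub>?U\<^esub> ?c \<ominus>\<^bsub>?U\<^esub> (?l \<oplus>\<^bsub>?U\<^esub> ?c)"
      unfolding f_def using cl by simp
    also have "\<dots> = ?l [^]\<^bsub>?U\<^esub> q \<ominus>\<^bsub>?U\<^esub> ?l"
      by (simp add: a_minus_def U.minus_add U.a_ac U.r_neg1 U.r_neg2)
    finally have f_l: "f = ?l [^]\<^bsub>?U\<^esub> q \<ominus>\<^bsub>?U\<^esub> ?l" .
    obtain g where g: "g \<in> carrier ?U" "f = ?l [^]\<^bsub>?U\<^esub> (2::nat) \<otimes>\<^bsub>?U\<^esub> g"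
      using le_alg_mult_imp_pdivides[OF a f le] by (auto simp: pdivides_def factor_def)
    \<comment> \<open>Since \<open>f\<close> equals both \<open>l^q - l\<close> and
      \<open>l^2 g\<close>, with \<open>l\<close> the linear factor at \<open>a\<close>, this
      \<open>d\<close> satisfies \<open>l * l * d = l\<close>. Cancelling \<open>l\<close> makes it
      a unit, although it vanishes at \<open>a\<close>.\<close>
    define d where "d = ?l [^]\<^bsub>?U\<^esub> (q - 2) \<ominus>\<^bsub>?U\<^esub> g"
    have d[simp]: "d \<in> carrier ?U" using g(1) by (simp add: d_def)
    have "?l \<otimes>\<^bsub>?U\<^esub> (?l \<otimes>\<^bsub>?U\<^esub> d) = ?l [^]\<^bsub>?U\<^esub> (2::nat) \<otimes>\<^bsub>?U\<^esub> d"
      by (simp add: numeral_2_eq_2 U.m_assoc)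
    also have "\<dots> = ?l [^]\<^bsub>?U\<^esub> (2::nat) \<otimes>\<^bsub>?U\<^esub> ?l [^]\<^bsub>?U\<^esub> (q - 2) \<ominus>\<^bsub>?U\<^esub> f"
      using g by (simp add: d_def a_minus_def U.r_distr U.r_minus)
    also have "?l [^]\<^bsub>?U\<^esub> (2::nat) \<otimes>\<^bsub>?U\<^esub> ?l [^]\<^bsub>?U\<^esub> (q - 2) = ?l [^]\<^bsub>?U\<^esub> q"
      using q by (simp only: U.nat_pow_mult[OF l] le_add_diff_inverse Suc_le_eq[symmetric] numeral_2_eq_2)
    also have "\<dots> \<ominus>\<^bsub>?U\<^esub> f = ?l \<otimes>\<^bsub>?U\<^esub> \<one>\<^bsub>?U\<^esub>"
      by (simp add: f_l a_minus_def U.minus_add U.r_neg1 U.r_neg2)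
    finally have "?l \<otimes>\<^bsub>?U\<^esub> d = \<one>\<^bsub>?U\<^esub>"
      by (subst (asm) U.m_lcancel) (simp_all add: univ_poly_zero)
    moreover interpret E: ring_hom_cring ?U L "\<lambda>p. eval p a"
      by (rule eval_cring_hom[OF carrier_is_subring a])
    have "eval ?l a = \<zero>" using a by (simp add: r_neg)
    then have "eval (?l \<otimes>\<^bsub>?U\<^esub> d) a = \<zero>" using E.hom_mult[OF l d] E.hom_closed[OF d] by simp
    ultimately show False using E.hom_one by simp
  qed
  have "{a. is_root f a} = K" using root_iff by blast
  from subst[where P = finite, OF this finite_number_of_roots[OF f]] show finK: "finite K" .
  have "count (roots f) a = (if a \<in> K then 1 else 0)" for a
  proof -
    have "alg_mult f a > 0 \<longleftrightarrow> a \<in> K"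
      by (simp only: alg_mult_gt_zero_iff_is_root[OF f] root_iff)
    moreover have "alg_mult f a \<le> 1" if "a \<in> K" using that by (intro simple) (simp only: K_def mem_Collect_eq)
    ultimately have "alg_mult f a = (if a \<in> K then 1 else 0)"
      by (cases "a \<in> K") simp_all
    then show ?thesis by (simp only: alg_mult_eq_count_roots[OF f])
  qed
  \<comment> \<open>Over an algebraically closed field the multiset of roots has size
    \<open>degree f = q\<close>; since all multiplicities are one, it is the set
    \<open>K\<close>.\<close>
  then have "roots f = mset_set K"
    by (intro multiset_eqI) (simp add: count_mset_set finK)
  moreover have "size (roots f) = q"
    using roots_over_carrier[OF f] unfolding splitted_def degf .
  ultimately show "card K = p ^ n" by (simp add: q_def)
qed


lemma residue_ring_add_pow_one:
  assumes "Factorial_Ring.prime (p::nat)"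
  shows "add_pow (residue_ring (int p)) p \<one>\<^bsub>residue_ring (int p)\<^esub> = \<zero>\<^bsub>residue_ring (int p)\<^esub>"
proof -
  interpret residues_prime p "residue_ring (int p)"
    by unfold_locales (simp_all add: assms)
  have "add_pow (residue_ring (int p)) n \<one>\<^bsub>residue_ring (int p)\<^esub> = int n mod int p" for n
    by (induction n) (auto simp: res_add_eq res_one_eq res_zero_eq mod_simps add.commute)
  then show ?thesis by (simp add: res_zero_eq)
qed

text \<open>Iterated Frobenius is additive and multiplicative, so its fixed points inherit the ring
  operations; for inverses, the power of \<open>inv k\<close> is again an inverse of
  \<open>k\<close>.\<close>

lemma (in field) frobenius_fixed_subfield:
  assumes p: "Factorial_Ring.prime (p::nat)" and ch: "add_pow R p \<one> = \<zero>"
  shows "subfield {x \<in> carrier R. x [^] (p ^ n) = x} R"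
proof -
  have p0: "p ^ n > 0" using prime_gt_0_nat[OF p] by simp
  \<comment> \<open>Deduced from additivity applied to \<open>\<ominus> x \<oplus> x\<close>, which
    treats odd \<open>p\<close> and \<open>p = 2\<close> alike.\<close>
  have m: "(\<ominus> x) [^] (p ^ n) = \<ominus> (x [^] (p ^ n))" if x: "x \<in> carrier R" for x
  proof -
    have "\<zero> = (\<ominus> x \<oplus> x) [^] (p ^ n)" using p0 x by (simp add: l_neg nat_pow_zero)
    also have "\<dots> = (\<ominus> x) [^] (p ^ n) \<oplus> x [^] (p ^ n)"
      using x by (intro frobenius_iter_add[OF p ch]) auto
    finally show ?thesis using x by (metis a_inv_closed minus_equality nat_pow_closed)
  qed
  show ?thesis
  proof (intro subfieldI' subringI)
    fix k assume "k \<in> {x \<in> carrier R. x [^] (p ^ n) = x} - {\<zero>}"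
    then have k: "k \<in> Units R" "k \<in> carrier R" "k [^] (p ^ n) = k" by (auto simp: field_Units)
    have "k \<otimes> inv k [^] (p ^ n) = (k \<otimes> inv k) [^] (p ^ n)"
      using k nat_pow_distrib[of k "inv k" "p ^ n"] by (simp del: Units_r_inv)
    also have "\<dots> = \<one>" using k by simp
    finally show "inv k \<in> {x \<in> carrier R. x [^] (p ^ n) = x}"
      using k comm_inv_char[of k "inv k [^] (p ^ n)"] by simp
  qed (auto simp: m nat_pow_distrib frobenius_iter_add[OF p ch] )
qed

text \<open>Take the fixed points of the \<open>n\<close>-fold Frobenius map inside the algebraic
  closure of the integers modulo \<open>p\<close>. The carrier type is the one in which that closure
  of \<open>residue_ring (int p)\<close> lives.\<close>

theorem exists_finite_field:
  assumes "primepow q"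
  shows "\<exists>R :: ((int list \<times> nat) multiset \<Rightarrow> int) ring.
           field R \<and> finite (carrier R) \<and> card (carrier R) = q"
proof -
  obtain p n where p: "Factorial_Ring.prime (p::nat)" and n: "n > 0" and q: "q = p ^ n"
    using assms by (auto simp: primepow_def)
  interpret Z: residues_prime p "residue_ring (int p)"
    by unfold_locales (simp_all add: p)
  let ?L = "Z.alg_closure"
  interpret L: algebraic_closure ?L "Z.indexed_const ` carrier (residue_ring (int p))"
    by (rule Z.alg_closureE)
  have ch: "add_pow ?L p \<one>\<^bsub>?L\<^esub> = \<zero>\<^bsub>?L\<^esub>"
    using ring_hom_add_pow[OF Z.alg_closureE(2) Z.ring_axioms L.ring_axioms, of "\<one>\<^bsub>residue_ring (int p)\<^esub>" p]
      ring_hom_one[OF Z.alg_closureE(2)] ring_hom_zero[OF Z.alg_closureE(2) Z.ring_axioms L.ring_axioms]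
      residue_ring_add_pow_one[OF p]
    by simp
  let ?K = "{x \<in> carrier ?L. x [^]\<^bsub>?L\<^esub> (p ^ n) = x}"
  have "field (?L\<lparr>carrier := ?K\<rparr>)"
    by (rule L.subfield_iff(2)[OF L.frobenius_fixed_subfield[OF p ch]])
  then show ?thesis
    using L.roots_of_frobenius_iterate[OF p ch n]
    by (intro exI[of _ "?L\<lparr>carrier := ?K\<rparr>"]) (simp add: q)
qed

section \<open>Slopes and Paley rows\<close>

lemma (in ring) minus_minus_cancel_right:
  assumes "x \<in> carrier R" "y \<in> carrier R" "z \<in> carrier R"
  shows "(x \<ominus> z) \<ominus> (y \<ominus> z) = x \<ominus> y"
proof -
  have "z \<oplus> (\<ominus> y \<oplus> \<ominus> z) = \<ominus> y" using assms by (simp add: a_lcomm[of z] r_neg)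
  then show ?thesis using assms by (simp add: a_minus_def minus_add a_ac)
qed

lemma (in ring) minus_minus_cancel_left:
  assumes "x \<in> carrier R" "y \<in> carrier R" "z \<in> carrier R"
  shows "(x \<ominus> z) \<ominus> (x \<ominus> y) = y \<ominus> z"
  using assms by (simp add: a_minus_def minus_add a_ac r_neg1 r_neg2)

context field
begin

definition slope :: "'a \<Rightarrow> 'a \<Rightarrow> 'a \<Rightarrow> 'a \<Rightarrow> 'a" where
  "slope i a j b = (a \<ominus> b) \<otimes> inv (i \<ominus> j)"

lemma minus_in_Units:
  "i \<in> carrier R \<Longrightarrow> j \<in> carrier R \<Longrightarrow> i \<noteq> j \<Longrightarrow> i \<ominus> j \<in> Units R"
  by (simp add: field_Units)

lemma slope_closed [simp]:
  "i \<in> carrier R \<Longrightarrow> a \<in> carrier R \<Longrightarrow> j \<in> carrier R \<Longrightarrow> b \<in> carrier R \<Longrightarrow> i \<noteq> j \<Longrightarrow>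
    slope i a j b \<in> carrier R"
  using minus_in_Units[of i j] by (simp add: slope_def)

lemma slope_eq_iff:
  assumes "i \<in> carrier R" "a \<in> carrier R" "j \<in> carrier R" "b \<in> carrier R" "i \<noteq> j" "m \<in> carrier R"
  shows "slope i a j b = m \<longleftrightarrow> a \<ominus> b = m \<otimes> (i \<ominus> j)"
proof -
  have u: "i \<ominus> j \<in> Units R" using assms by (intro minus_in_Units)
  show ?thesis using assms u by (auto simp: slope_def m_assoc)
qed

lemma slope_sym:
  assumes "i \<in> carrier R" "a \<in> carrier R" "j \<in> carrier R" "b \<in> carrier R" "i \<noteq> j"
  shows "slope i a j b = slope j b i a"
proof -
  let ?m = "slope j b i a"
  have "b \<ominus> a = ?m \<otimes> (j \<ominus> i)" using assms slope_eq_iff[of j b i a ?m] by simp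
  then have "\<ominus> (b \<ominus> a) = ?m \<otimes> \<ominus> (j \<ominus> i)" using assms by (simp add: r_minus)
  moreover have "\<ominus> (x \<ominus> y) = y \<ominus> x" if "x \<in> carrier R" "y \<in> carrier R" for x y
    using that by (simp add: a_minus_def minus_add a_comm)
  ultimately show ?thesis using assms by (subst slope_eq_iff) auto
qed

text \<open>The points of column \<open>j\<close> correspond to the non-vertical lines through
  \<open>(i, a)\<close>; the witness \<open>a \<ominus> m \<otimes> (i \<ominus> j)\<close> is the
  height at which the line of slope \<open>m\<close> meets that column.\<close>

lemma bij_betw_slope:
  assumes "i \<in> carrier R" "a \<in> carrier R" "j \<in> carrier R" "i \<noteq> j"
  shows "bij_betw (slope i a j) (carrier R) (carrier R)"
proof (rule bij_betw_byWitness[where f' = "\<lambda>m. a \<ominus> m \<otimes> (i \<ominus> j)"])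
  show "\<forall>b\<in>carrier R. a \<ominus> slope i a j b \<otimes> (i \<ominus> j) = b"
  proof
    fix b assume b: "b \<in> carrier R"
    have "slope i a j b \<otimes> (i \<ominus> j) = a \<ominus> b"
      using slope_eq_iff[of i a j b "slope i a j b"] assms b by simp
    then show "a \<ominus> slope i a j b \<otimes> (i \<ominus> j) = b"
      using assms b by (simp add: a_minus_def minus_add r_neg1 r_neg2)
  qed
  show "\<forall>m\<in>carrier R. slope i a j (a \<ominus> m \<otimes> (i \<ominus> j)) = m"
    using assms by (simp add: slope_eq_iff) (simp add: a_minus_def minus_add r_neg1 r_neg2)
qed (use assms in auto)

text \<open>Either side says that the three points are collinear. With \<open>?m\<close> the slope
  between \<open>(i, a)\<close> and \<open>(l, c)\<close>, subtraction from
  \<open>a \<ominus> c = ?m \<otimes> (i \<ominus> l)\<close> turns the condition on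
  \<open>b\<close>, \<open>c\<close> into the one on \<open>a\<close>, \<open>b\<close>, and
  conversely.\<close>

lemma slope_eq_slope_iff:
  assumes "i \<in> carrier R" "a \<in> carrier R" "j \<in> carrier R" "b \<in> carrier R"
    "l \<in> carrier R" "c \<in> carrier R" "i \<noteq> j" "l \<noteq> i" "l \<noteq> j"
  shows "slope i a l c = slope j b l c \<longleftrightarrow> slope i a l c = slope i a j b"
proof -
  let ?m = "slope i a l c"
  have m: "?m \<in> carrier R" and ac: "a \<ominus> c = ?m \<otimes> (i \<ominus> l)"
    using assms slope_eq_iff[of i a l c ?m] by simp_all
  have distrib: "?m \<otimes> (x \<ominus> y) = ?m \<otimes> x \<ominus> ?m \<otimes> y"
    if "x \<in> carrier R" "y \<in> carrier R" for x y
    using that m by (simp add: a_minus_def r_distr r_minus)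
  have "slope j b l c = ?m \<longleftrightarrow> b \<ominus> c = ?m \<otimes> (j \<ominus> l)"
    using assms m by (intro slope_eq_iff) auto
  also have "\<dots> \<longleftrightarrow> a \<ominus> b = ?m \<otimes> (i \<ominus> j)"
  proof
    assume "b \<ominus> c = ?m \<otimes> (j \<ominus> l)"
    then have "(a \<ominus> c) \<ominus> (b \<ominus> c) = ?m \<otimes> ((i \<ominus> l) \<ominus> (j \<ominus> l))"
      using distrib[of "i \<ominus> l" "j \<ominus> l"] assms by (simp only: ac minus_closed)
    then show "a \<ominus> b = ?m \<otimes> (i \<ominus> j)" using assms by (simp add: minus_minus_cancel_right)
  next
    assume "a \<ominus> b = ?m \<otimes> (i \<ominus> j)"
    then have "(a \<ominus> c) \<ominus> (a \<ominus> b) = ?m \<otimes> ((i \<ominus> l) \<ominus> (i \<ominus> j))"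
      using distrib[of "i \<ominus> l" "i \<ominus> j"] assms by (simp only: ac minus_closed)
    then show "b \<ominus> c = ?m \<otimes> (j \<ominus> l)" using assms by (simp add: minus_minus_cancel_left)
  qed
  also have "\<dots> \<longleftrightarrow> slope i a j b = ?m"
    using assms m by (intro slope_eq_iff[symmetric]) auto
  finally show ?thesis by (simp only: eq_commute[of ?m])
qed

end

section \<open>The quadratic character and its sums\<close>

lemma (in field) inv_mult_Units:
  "x \<in> Units R \<Longrightarrow> y \<in> Units R \<Longrightarrow> inv (x \<otimes> y) = inv x \<otimes> inv y"
proof -
  assume xy: "x \<in> Units R" "y \<in> Units R"
  have "x \<otimes> y \<otimes> (inv x \<otimes> inv y) = (x \<otimes> inv x) \<otimes> (y \<otimes> inv y)"
    using Units_closed[OF xy(1)] Units_closed[OF xy(2)] xy by (simp only: m_ac m_closed Units_inv_closed)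
  then show ?thesis using xy by (intro comm_inv_char) auto
qed

locale paley_field = field +
  assumes fin: "finite (carrier R)" and card_mod: "card (carrier R) mod 4 = 3"
begin

abbreviation "half \<equiv> (card (carrier R) - 1) div 2"

lemma odd_half: "odd half" using card_mod by presburger

lemma card_carrier: "card (carrier R) = Suc (2 * half)"
  using card_mod by presburger

text \<open>The order of the field annihilates \<open>\<one>\<close> in the additive group. This
  order is odd, whereas \<open>\<one> = \<ominus> \<one>\<close> would make all even multiples of
  \<open>\<one>\<close> vanish, leaving \<open>\<one> = \<zero>\<close>.\<close>

lemma one_neq_minus_one: "\<one> \<noteq> \<ominus> \<one>"
proof
  assume "\<one> = \<ominus> \<one>"
  then have "\<one> \<oplus> \<one> = \<zero>" by (metis one_closed r_neg)
  then have two: "add_pow R (2 * k) \<one> = \<zero>" for k :: nat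
    by (induction k) auto
  have "add_pow R (card (carrier R)) \<one> = \<zero>"
    using add.pow_order_eq_1[of \<one>] by (simp add: Coset.order_def)
  then show False by (subst (asm) card_carrier) (simp add: two)
qed

text \<open>By Lagrange's theorem in the multiplicative group, \<open>x [^] half\<close> squares to
  \<open>\<one>\<close>, and a field has no square roots of \<open>\<one>\<close> besides
  \<open>\<one>\<close> and \<open>\<ominus> \<one>\<close>.\<close>

lemma pow_half_cases:
  assumes "x \<in> carrier R" "x \<noteq> \<zero>"
  shows "x [^] half = \<one> \<or> x [^] half = \<ominus> \<one>"
proof -
  let ?y = "x [^] half"
  have y: "?y \<in> carrier R" using assms by simp
  have "x [^] (card (carrier R) - 1) = \<one>"
  proof -
    interpret M: group "Multiplicative_Group.mult_of R" by (rule field_mult_group)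
    have "x [^] Coset.order (Multiplicative_Group.mult_of R) = \<one>"
      using assms M.pow_order_eq_1[of x] by (simp add: Multiplicative_Group.nat_pow_mult_of)
    then show ?thesis using order_mult_of[OF fin] by (simp add: Coset.order_def)
  qed
  then have "?y \<otimes> ?y = \<one>"
    using assms by (subst (asm) card_carrier) (simp add: nat_pow_mult mult_2)
  then have "(?y \<ominus> \<one>) \<otimes> (?y \<oplus> \<one>) = \<zero>"
    using y by (simp add: a_minus_def l_distr r_distr l_minus a_ac r_neg1 r_neg2 r_neg l_neg)
  then have "?y \<ominus> \<one> = \<zero> \<or> ?y \<oplus> \<one> = \<zero>" using y by (intro integral) auto
  then show ?thesis using y minus_equality[of ?y \<one>] by auto
qed

text \<open>Quadratic character, given by Euler's criterion: since the exponent is odd, \<open>chi\<close> is an odd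
  multiplicative function, which is all that the Paley construction needs.\<close>

definition chi :: "'a \<Rightarrow> real" where
  "chi x = (if x = \<zero> then 0 else if x [^] half = \<one> then 1 else - 1)"

lemma chi_zero [simp]: "chi \<zero> = 0" by (simp add: chi_def)
lemma chi_one [simp]: "chi \<one> = 1" by (simp add: chi_def)

lemma chi_square [simp]: "x \<noteq> \<zero> \<Longrightarrow> chi x * chi x = 1" by (simp add: chi_def)

lemma chi_mult:
  assumes "x \<in> carrier R" "y \<in> carrier R"
  shows "chi (x \<otimes> y) = chi x * chi y"
proof (cases "x = \<zero> \<or> y = \<zero>")
  case False
  then have *: "x \<noteq> \<zero>" "y \<noteq> \<zero>" "x \<otimes> y \<noteq> \<zero>" using assms by (auto simp: integral_iff)
  have xy: "(x \<otimes> y) [^] half = x [^] half \<otimes> y [^] half" using assms by (rule nat_pow_distrib)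
  have "chi (x \<otimes> y) = (if x [^] half \<otimes> y [^] half = \<one> then 1 else - 1)"
    using * by (simp only: chi_def xy if_False)
  also have "\<dots> = (if x [^] half = \<one> then 1 else - 1) * (if y [^] half = \<one> then 1 else - 1)"
    using pow_half_cases[OF assms(1) *(1)] pow_half_cases[OF assms(2) *(2)] one_neq_minus_one
    by (elim disjE) (simp_all add: l_minus r_minus)
  finally show ?thesis using * by (simp only: chi_def if_False)
qed (use assms in auto)

lemma minus_one_pow_odd: "odd (n::nat) \<Longrightarrow> (\<ominus> \<one>) [^] n = \<ominus> \<one>"
proof (elim oddE)
  fix b assume n: "n = 2 * b + 1"
  have "(\<ominus> \<one>) [^] (2::nat) = \<one>" by (simp add: numeral_2_eq_2 l_minus)
  then have "(\<ominus> \<one>) [^] (2 * b) = \<one>" by (simp only: nat_pow_pow[symmetric] a_inv_closed one_closed nat_pow_one)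
  then show ?thesis unfolding n by (simp del: mult_2)
qed

lemma chi_uminus:
  assumes "x \<in> carrier R"
  shows "chi (\<ominus> x) = - chi x"
proof -
  have "chi (\<ominus> \<one>) = - 1"
    using one_neq_minus_one minus_one_pow_odd[OF odd_half] by (auto simp: chi_def)
  then show ?thesis using chi_mult[of "\<ominus> \<one>" x] assms by (simp add: l_minus)
qed

text \<open>Negation permutes the field and, \<open>chi\<close> being odd, changes the sign of the
  sum.\<close>

lemma sum_chi: "(\<Sum>x\<in>carrier R. chi x) = 0"
proof -
  have "(\<Sum>x\<in>carrier R. chi x) = (\<Sum>x\<in>carrier R. chi (\<ominus> x))"
    by (rule sum.reindex_bij_witness[of _ "\<lambda>x. \<ominus> x" "\<lambda>x. \<ominus> x"]) auto
  also have "\<dots> = - (\<Sum>x\<in>carrier R. chi x)" by (simp add: chi_uminus sum_negf)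
  finally show ?thesis by simp
qed

text \<open>For nonzero \<open>x\<close>, factoring out \<open>x\<close> turns the summand into
  \<open>chi (\<one> \<oplus> c \<otimes> inv x)\<close>, whose argument runs through every element
  except \<open>\<one>\<close>. So the sum is the full character sum \<open>0\<close> minus
  \<open>chi \<one> = 1\<close>.\<close>

lemma sum_chi_mult_chi_add:
  assumes c: "c \<in> carrier R" "c \<noteq> \<zero>"
  shows "(\<Sum>x\<in>carrier R. chi x * chi (x \<oplus> c)) = - 1"
proof -
  let ?N = "carrier R - {\<zero>}"
  have N: "?N = Units R" by (simp add: field_Units)
  have cU: "c \<in> Units R" using c by (simp add: field_Units)
  have "(\<Sum>x\<in>carrier R. chi x * chi (x \<oplus> c)) = (\<Sum>x\<in>?N. chi x * chi (x \<oplus> c))"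
    using fin by (intro sum.mono_neutral_right) auto
  also have "\<dots> = (\<Sum>x\<in>?N. chi (\<one> \<oplus> c \<otimes> inv x))"
  proof (rule sum.cong[OF refl])
    fix x assume x: "x \<in> ?N"
    then have xu: "x \<in> Units R" "x \<in> carrier R" using N by auto
    have "x \<oplus> c = x \<otimes> (\<one> \<oplus> c \<otimes> inv x)"
      using xu c by (simp add: r_distr m_lcomm)
    then have "chi (x \<oplus> c) = chi x * chi (\<one> \<oplus> c \<otimes> inv x)" using xu c by (simp add: chi_mult)
    then show "chi x * chi (x \<oplus> c) = chi (\<one> \<oplus> c \<otimes> inv x)"
      using x chi_square[of x] by (simp flip: mult.assoc del: chi_square)
  qed
  also have "\<dots> = (\<Sum>y\<in>carrier R - {\<one>}. chi y)"
  proof (rule sum.reindex_bij_betw)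
    show "bij_betw (\<lambda>x. \<one> \<oplus> c \<otimes> inv x) ?N (carrier R - {\<one>})"
    proof (rule bij_betw_byWitness[where f' = "\<lambda>y. c \<otimes> inv (y \<ominus> \<one>)"])
      show "\<forall>x\<in>?N. c \<otimes> inv (\<one> \<oplus> c \<otimes> inv x \<ominus> \<one>) = x"
      proof
        fix x assume "x \<in> ?N"
        then have xu: "x \<in> Units R" "x \<in> carrier R" using N by auto
        have cu: "c \<in> Units R" using c by (simp add: field_Units)
        have "\<one> \<oplus> c \<otimes> inv x \<ominus> \<one> = c \<otimes> inv x"
          using xu c by (simp add: a_minus_def a_ac r_neg1 r_neg2)
        then show "c \<otimes> inv (\<one> \<oplus> c \<otimes> inv x \<ominus> \<one>) = x"
          using xu cu c by (simp add: inv_mult_Units flip: m_assoc)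
      qed
      show "\<forall>y\<in>carrier R - {\<one>}. \<one> \<oplus> c \<otimes> inv (c \<otimes> inv (y \<ominus> \<one>)) = y"
      proof
        fix y assume y: "y \<in> carrier R - {\<one>}"
        then have u: "y \<ominus> \<one> \<in> Units R" by (intro minus_in_Units) auto
        have cu: "c \<in> Units R" using c by (simp add: field_Units)
        have "c \<otimes> inv (c \<otimes> inv (y \<ominus> \<one>)) = y \<ominus> \<one>"
          using u cu c y by (simp add: inv_mult_Units flip: m_assoc)
        then show "\<one> \<oplus> c \<otimes> inv (c \<otimes> inv (y \<ominus> \<one>)) = y"
          using y by (simp add: a_minus_def a_ac r_neg1 r_neg2 r_neg)
      qed
      show "(\<lambda>x. \<one> \<oplus> c \<otimes> inv x) ` ?N \<subseteq> carrier R - {\<one>}"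
      proof (intro image_subsetI)
        fix x assume "x \<in> ?N"
        then have "c \<otimes> inv x \<in> Units R" using cU N by (intro Units_m_closed Units_inv_Units) auto
        then have "c \<otimes> inv x \<in> carrier R" "c \<otimes> inv x \<noteq> \<zero>" by (auto simp: field_Units)
        then show "\<one> \<oplus> c \<otimes> inv x \<in> carrier R - {\<one>}"
          by (metis DiffI add.l_cancel add.m_closed one_closed r_zero singletonD zero_closed)
      qed
      show "(\<lambda>y. c \<otimes> inv (y \<ominus> \<one>)) ` (carrier R - {\<one>}) \<subseteq> ?N"
      proof (intro image_subsetI)
        fix y assume "y \<in> carrier R - {\<one>}"
        then have "y \<ominus> \<one> \<in> Units R" by (intro minus_in_Units) auto
        then show "c \<otimes> inv (y \<ominus> \<one>) \<in> ?N"
          unfolding N using cU N by (intro Units_m_closed Units_inv_Units) auto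
      qed
    qed
  qed
  also have "\<dots> = - 1" using fin by (simp add: sum_diff1 sum_chi)
  finally show ?thesis .
qed


lemma sum_chi_diff:
  assumes a: "a \<in> carrier R"
  shows "(\<Sum>x\<in>carrier R. chi (x \<ominus> a)) = 0" "(\<Sum>x\<in>carrier R. chi (a \<ominus> x)) = 0"
proof -
  have "(\<Sum>x\<in>carrier R. chi (x \<ominus> a)) = (\<Sum>x\<in>carrier R. chi x)"
    by (rule sum.reindex_bij_witness[of _ "\<lambda>x. x \<oplus> a" "\<lambda>x. x \<ominus> a"])
       (use a in \<open>auto simp: a_minus_def a_assoc l_neg r_neg\<close>)
  then show "(\<Sum>x\<in>carrier R. chi (x \<ominus> a)) = 0" by (simp add: sum_chi)
  moreover have "chi (a \<ominus> x) = - chi (x \<ominus> a)" if "x \<in> carrier R" for x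
    using chi_uminus[of "x \<ominus> a"] that a by (simp add: a_minus_def minus_add a_comm)
  ultimately show "(\<Sum>x\<in>carrier R. chi (a \<ominus> x)) = 0" by (simp add: sum_negf)
qed

lemma chi_diff_commute:
  "a \<in> carrier R \<Longrightarrow> b \<in> carrier R \<Longrightarrow> chi (a \<ominus> b) = - chi (b \<ominus> a)"
  using chi_uminus[of "b \<ominus> a"] by (simp add: a_minus_def minus_add a_comm)

lemma sum_chi_diff_mult_chi_diff:
  assumes "a \<in> carrier R" "b \<in> carrier R" "a \<noteq> b"
  shows "(\<Sum>x\<in>carrier R. chi (x \<ominus> a) * chi (x \<ominus> b)) = - 1"
    and "(\<Sum>x\<in>carrier R. chi (a \<ominus> x) * chi (b \<ominus> x)) = - 1"
proof -
  have "(\<Sum>x\<in>carrier R. chi (x \<ominus> a) * chi (x \<ominus> b))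
      = (\<Sum>x\<in>carrier R. chi x * chi (x \<oplus> (a \<ominus> b)))"
    by (rule sum.reindex_bij_witness[of _ "\<lambda>x. x \<oplus> a" "\<lambda>x. x \<ominus> a"])
       (use assms in \<open>auto simp: a_minus_def a_assoc l_neg r_neg r_neg1\<close>)
  also have "\<dots> = - 1" using assms by (intro sum_chi_mult_chi_add) auto
  finally show "(\<Sum>x\<in>carrier R. chi (x \<ominus> a) * chi (x \<ominus> b)) = - 1" .
  then show "(\<Sum>x\<in>carrier R. chi (a \<ominus> x) * chi (b \<ominus> x)) = - 1"
    using assms by (simp add: chi_diff_commute[of a] chi_diff_commute[of b])
qed

section \<open>Rows of the Paley Hadamard matrix\<close>

text \<open>The entry \<open>- 1\<close> at \<open>u = m\<close> replaces \<open>chi \<zero> = 0\<close>; the point \<open>None\<close> is the one at infinity.\<close>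

fun paley_row :: "'a \<Rightarrow> 'a option \<Rightarrow> real" where
  "paley_row m None = 1"
| "paley_row m (Some u) = (if u = m then - 1 else chi (u \<ominus> m))"

definition "paley_points = insert None (Some ` carrier R)"

lemma card_paley_points: "finite paley_points" "card paley_points = card (carrier R) + 1"
  using fin by (auto simp: paley_points_def card_image)

lemma sum_paley_points:
  "(\<Sum>u\<in>paley_points. f u) = f None + (\<Sum>u\<in>carrier R. f (Some u))" for f :: "_ \<Rightarrow> real"
  using fin by (simp add: paley_points_def sum.reindex)

text \<open>Valid also at \<open>u = m\<close>, where \<open>chi\<close> vanishes. In this form,
  sums over \<open>u\<close> split into a character sum and a single correction term.\<close>

lemma paley_row_Some:
  "m \<in> carrier R \<Longrightarrow> u \<in> carrier R \<Longrightarrow> paley_row m (Some u) = chi (u \<ominus> m) - (if u = m then 1 else 0)"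
  by (auto simp: a_minus_def r_neg)

lemma paley_row_square:
  assumes "m \<in> carrier R" "u \<in> paley_points"
  shows "paley_row m u * paley_row m u = 1"
  using assms by (cases u) (auto simp: paley_points_def)

lemma sum_paley_row:
  assumes "m \<in> carrier R"
  shows "(\<Sum>u\<in>paley_points. paley_row m u) = 0"
  using assms fin
  by (simp add: sum_paley_points paley_row_Some sum_subtractf sum_chi_diff sum.delta' del: paley_row.simps(2))

text \<open>The character sum \<open>- 1\<close> is cancelled by the product \<open>1\<close> at
  infinity, and the corrections at \<open>u = m\<close> and \<open>u = m'\<close> cancel each other
  because \<open>chi\<close> is odd.\<close>

lemma sum_paley_rows:
  assumes m: "m \<in> carrier R" "m' \<in> carrier R" "m \<noteq> m'"
  shows "(\<Sum>u\<in>paley_points. paley_row m u * paley_row m' u) = 0"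
proof -
  have "(\<Sum>u\<in>carrier R. paley_row m (Some u) * paley_row m' (Some u))
      = (\<Sum>u\<in>carrier R. chi (u \<ominus> m) * chi (u \<ominus> m') - (if u = m then chi (m \<ominus> m') else 0)
           - (if u = m' then chi (m' \<ominus> m) else 0))"
    using m by (intro sum.cong refl) (auto simp: paley_row_Some algebra_simps simp del: paley_row.simps)
  also have "\<dots> = - 1"
    using m fin chi_diff_commute[of m m']
    by (simp add: sum_subtractf sum_chi_diff_mult_chi_diff)
  finally show ?thesis by (simp add: sum_paley_points)
qed

text \<open>Columns of the full Hadamard matrix are orthogonal; the index \<open>m\<close> leaves
  out its constant row, whose contribution \<open>1\<close> is missing, hence
  \<open>- 1\<close>.\<close>

lemma sum_paley_columns:
  assumes u: "u \<in> paley_points" "v \<in> paley_points" "u \<noteq> v"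
  shows "(\<Sum>m\<in>carrier R. paley_row m u * paley_row m v) = - 1"
proof -
  have *: "(\<Sum>m\<in>carrier R. paley_row m (Some x)) = - 1" if "x \<in> carrier R" for x
    using that fin
    by (simp add: paley_row_Some sum_subtractf sum_chi_diff del: paley_row.simps(2))
  show ?thesis
  proof (cases u)
    case None
    then show ?thesis using u * by (auto simp: paley_points_def simp del: paley_row.simps(2))
  next
    case (Some x)
    show ?thesis
    proof (cases v)
      case None
      then show ?thesis using u * by (auto simp: paley_points_def simp del: paley_row.simps(2))
    next
      case (Some y)
      with \<open>u = Some x\<close> u have xy: "x \<in> carrier R" "y \<in> carrier R" "x \<noteq> y"
        by (auto simp: paley_points_def)
      have "(\<Sum>m\<in>carrier R. paley_row m u * paley_row m v)
        = (\<Sum>m\<in>carrier R. chi (x \<ominus> m) * chi (y \<ominus> m) - (if m = x then chi (y \<ominus> x) else 0)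
             - (if m = y then chi (x \<ominus> y) else 0))"
        unfolding Some \<open>u = Some x\<close>
        using xy by (intro sum.cong refl) (auto simp: paley_row_Some algebra_simps simp del: paley_row.simps)
      also have "\<dots> = - 1"
        using xy fin chi_diff_commute[of x y]
        by (simp add: sum_subtractf sum_chi_diff_mult_chi_diff)
      finally show ?thesis .
    qed
  qed
qed

end

section \<open>The graph\<close>

text \<open>Reduces closure of a span under a bilinear product to products of generators: first
  \<open>M\<close> varies with \<open>N\<close> in \<open>B\<close>, then \<open>N\<close> varies.
  Serves both matrix and entrywise multiplication.\<close>

lemma span_closed_bilinear:
  assumes add: "\<And>M M' N. f (M + M') N = f M N + f M' N" "\<And>M N N'. f M (N + N') = f M N + f M N'"
    and scale: "\<And>k M N. f (scale_mat k M) N = scale_mat k (f M N)"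
      "\<And>k M N. f M (scale_mat k N) = scale_mat k (f M N)"
    and basis: "\<And>M N. M \<in> B \<Longrightarrow> N \<in> B \<Longrightarrow> f M N \<in> rmat.span B"
    and MN: "M \<in> rmat.span B" "N \<in> rmat.span B"
  shows "f M N \<in> rmat.span B"
proof -
  have zero: "f 0 N = 0" "f M 0 = 0" for M N
    using scale(1)[of 0 0 N] scale(2)[of M 0 0] by (simp_all only: rmat.scale_zero_left)
  note span = rmat.span_zero rmat.span_add rmat.span_scale
  have "f M N \<in> rmat.span B" if N: "N \<in> B" for N
  proof (rule rmat.span_induct[OF MN(1)])
    show "rmat.subspace {M. f M N \<in> rmat.span B}"
      by (rule rmat.subspaceI) (simp_all only: mem_Collect_eq zero add scale span)
  qed (rule basis[OF _ N])
  then have "B \<subseteq> {N. f M N \<in> rmat.span B}" by blast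
  moreover have "rmat.subspace {N. f M N \<in> rmat.span B}"
    by (rule rmat.subspaceI) (simp_all only: mem_Collect_eq zero add scale span)
  ultimately have "rmat.span B \<subseteq> {N. f M N \<in> rmat.span B}" by (rule rmat.span_minimal)
  with MN(2) show ?thesis by blast
qed

text \<open>Agreement of two fixed entries is a linear condition and so passes from \<open>B\<close>
  to its span. Used to prove linear independence of the basis matrices.\<close>

lemma not_in_span_if_separated:
  assumes "\<And>N. N \<in> B \<Longrightarrow> N x y = N x' y'" and "M x y \<noteq> M x' y'"
  shows "M \<notin> rmat.span B"
proof -
  have "rmat.subspace {N. N x y = N x' y'}"
    by (rule rmat.subspaceI) (simp_all add: scale_mat_def)
  then have "rmat.span B \<subseteq> {N. N x y = N x' y'}"
    by (rule rmat.span_minimal[rotated]) (use assms(1) in blast)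
  with assms(2) show ?thesis by blast
qed

lemma mult_id_mat:
  assumes "finite V" "M \<in> mats_on V"
  shows "mult_mat V (id_mat V) M = M" "mult_mat V M (id_mat V) = M"
proof -
  have "(\<Sum>z\<in>V. id_mat V x z * M z y) = M x y" "(\<Sum>z\<in>V. M x z * id_mat V z y) = M x y" for x y
  proof -
    have M: "M x y = 0" if "x \<notin> V \<or> y \<notin> V" using assms(2) that unfolding mats_on_def by blast
    have "(\<Sum>z\<in>V. id_mat V x z * M z y) = (\<Sum>z\<in>V. if x = z then M x y else 0)"
      by (intro sum.cong) (auto simp: id_mat_def)
    also have "\<dots> = M x y" using assms(1) M by (cases "x \<in> V") simp_all
    finally show "(\<Sum>z\<in>V. id_mat V x z * M z y) = M x y" .
    have "(\<Sum>z\<in>V. M x z * id_mat V z y) = (\<Sum>z\<in>V. if y = z then M x y else 0)"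
      by (intro sum.cong) (auto simp: id_mat_def)
    also have "\<dots> = M x y" using assms(1) M by (cases "y \<in> V") simp_all
    finally show "(\<Sum>z\<in>V. M x z * id_mat V z y) = M x y" .
  qed
  then show "mult_mat V (id_mat V) M = M" "mult_mat V M (id_mat V) = M"
    by (simp_all add: mult_mat_def)
qed

lemma card_gt_1_obtain_other:
  assumes "card A > 1"
  obtains b where "b \<in> A" "b \<noteq> a"
proof -
  have "\<not> A \<subseteq> {a}"
  proof
    assume "A \<subseteq> {a}"
    then have "card A \<le> card {a}" by (rule card_mono[rotated]) simp
    with assms show False by simp
  qed
  with that show ?thesis by blast
qed

section \<open>Abstract setting and adjacency matrix\<close>

text \<open>A vertex has a column \<open>c\<close>, a row \<open>r\<close> and a Hadamard coordinate
  \<open>u\<close>. Keeping \<open>V\<close> abstract behind the bijection \<open>bij\<close> lets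
  the vertices be natural numbers. The field enters only through incidence of lines
  (\<open>sl\<close>) and orthogonality of sign vectors (\<open>h\<close>).\<close>

locale slope_graph =
  fixes V :: "'v set" and c :: "'v \<Rightarrow> 't" and r :: "'v \<Rightarrow> 'f" and u :: "'v \<Rightarrow> 'u"
    and T :: "'t set" and F :: "'f set" and U :: "'u set"
    and sl :: "'t \<Rightarrow> 'f \<Rightarrow> 't \<Rightarrow> 'f \<Rightarrow> 'f" and h :: "'f \<Rightarrow> 'u \<Rightarrow> real" and q :: nat
  assumes fin: "finite T" "finite F" "finite U"
    and cards: "card T = q - 2" "card F = q" "card U = q + 1" "q \<ge> 7"
    and bij: "bij_betw (\<lambda>x. (c x, r x, u x)) V (T \<times> F \<times> U)"
    and sl_sym: "\<lbrakk>i \<in> T; j \<in> T; i \<noteq> j; a \<in> F; b \<in> F\<rbrakk> \<Longrightarrow> sl i a j b = sl j b i a"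
    and sl_bij: "\<lbrakk>i \<in> T; j \<in> T; i \<noteq> j; a \<in> F\<rbrakk> \<Longrightarrow> bij_betw (sl i a j) F F"
    and sl_eq_iff: "\<lbrakk>i \<in> T; j \<in> T; l \<in> T; i \<noteq> j; l \<noteq> i; l \<noteq> j; a \<in> F; b \<in> F; d \<in> F\<rbrakk>
      \<Longrightarrow> sl i a l d = sl j b l d \<longleftrightarrow> sl i a l d = sl i a j b"
    and h_square: "\<lbrakk>m \<in> F; w \<in> U\<rbrakk> \<Longrightarrow> h m w * h m w = 1"
    and h_sum: "m \<in> F \<Longrightarrow> (\<Sum>w\<in>U. h m w) = 0"
    and h_orth: "\<lbrakk>m \<in> F; m' \<in> F; m \<noteq> m'\<rbrakk> \<Longrightarrow> (\<Sum>w\<in>U. h m w * h m' w) = 0"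
    and h_cols: "\<lbrakk>w \<in> U; w' \<in> U; w \<noteq> w'\<rbrakk> \<Longrightarrow> (\<Sum>m\<in>F. h m w * h m w') = - 1"
begin

definition m :: "'v \<Rightarrow> 'v \<Rightarrow> 'f" where "m x y = sl (c x) (r x) (c y) (r y)"

definition P :: "'v rmat" where
  "P x y = of_bool (x \<in> V \<and> y \<in> V \<and> c x = c y \<and> r x = r y)"

definition Q :: "'v rmat" where
  "Q x y = of_bool (x \<in> V \<and> y \<in> V \<and> c x = c y)"

definition S :: "'v rmat" where
  "S x y = (if x \<in> V \<and> y \<in> V \<and> c x \<noteq> c y then h (m x y) (u x) * h (m x y) (u y) else 0)"

abbreviation "I \<equiv> id_mat V"
abbreviation "J \<equiv> ones_mat V"

definition G :: "'v pair_pre_digraph" where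
  "G = \<lparr>pverts = V, parcs = {(x, y). x \<in> V \<and> y \<in> V \<and>
      (if c x = c y then r x \<noteq> r y else h (m x y) (u x) = h (m x y) (u y))}\<rparr>"

abbreviation "A \<equiv> adj_mat G"

lemma pverts_G [simp]: "pverts G = V" by (simp add: G_def)

lemma finite_V [simp]: "finite V"
  using bij_betw_finite[OF bij] fin by simp

lemma card_V: "card V = (q - 2) * (q * (q + 1))"
  using bij_betw_same_card[OF bij] cards by (simp add: card_cartesian_product)

lemma card_gt_1: "card T > 1" "card F > 1" "card U > 1"
  using cards by linarith+

lemma not_empty: "T \<noteq> {}" "F \<noteq> {}" "U \<noteq> {}"
  using card_gt_1 by (metis card.empty not_less_zero)+

lemma real_q_minus_2: "real (q - 2) = real q - 2" using cards by simp

lemma real_card_V: "real (card V) = (real q - 2) * (real q * (real q + 1))"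
  by (simp only: card_V of_nat_mult real_q_minus_2 of_nat_add of_nat_1)

lemma V_mem: "x \<in> V \<Longrightarrow> c x \<in> T" "x \<in> V \<Longrightarrow> r x \<in> F" "x \<in> V \<Longrightarrow> u x \<in> U"
  using bij by (auto simp: bij_betw_def)

lemma V_eqI: "x \<in> V \<Longrightarrow> y \<in> V \<Longrightarrow> c x = c y \<Longrightarrow> r x = r y \<Longrightarrow> u x = u y \<Longrightarrow> x = y"
  using bij by (auto simp: bij_betw_def inj_on_def)

lemma V_ex: "t \<in> T \<Longrightarrow> s \<in> F \<Longrightarrow> w \<in> U \<Longrightarrow> \<exists>x\<in>V. c x = t \<and> r x = s \<and> u x = w"
proof -
  assume "t \<in> T" "s \<in> F" "w \<in> U"
  then have "(t, s, w) \<in> (\<lambda>x. (c x, r x, u x)) ` V" using bij by (simp add: bij_betw_def)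
  then show ?thesis by auto
qed

lemma sum_V:
  "(\<Sum>z\<in>V. f (c z) (r z) (u z)) = (\<Sum>t\<in>T. \<Sum>s\<in>F. \<Sum>w\<in>U. f t s w)" for f :: "_ \<Rightarrow> _ \<Rightarrow> _ \<Rightarrow> real"
  using sum.reindex_bij_betw[OF bij, of "\<lambda>(t, s, w). f t s w"]
  by (simp add: sum.cartesian_product)

lemma sl_mem: "\<lbrakk>i \<in> T; j \<in> T; i \<noteq> j; a \<in> F; b \<in> F\<rbrakk> \<Longrightarrow> sl i a j b \<in> F"
  using sl_bij[of i j a] by (auto simp: bij_betw_def)

lemma m_mem: "\<lbrakk>x \<in> V; y \<in> V; c x \<noteq> c y\<rbrakk> \<Longrightarrow> m x y \<in> F"
  by (simp add: m_def sl_mem V_mem)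

lemma m_sym: "\<lbrakk>x \<in> V; y \<in> V; c x \<noteq> c y\<rbrakk> \<Longrightarrow> m x y = m y x"
  unfolding m_def by (intro sl_sym V_mem)

lemma h_cases:
  "k \<in> F \<Longrightarrow> w \<in> U \<Longrightarrow> h k w = 1 \<or> h k w = - 1"
  using h_square[of k w] by (auto simp: square_eq_1_iff)

lemma sym: "P x y = P y x" "Q x y = Q y x" "I x y = I y x" "J x y = J y x" "S x y = S y x"
  by (auto simp: P_def Q_def S_def id_mat_def ones_mat_def m_sym)

text \<open>Within a column \<open>S\<close> vanishes and the rest is \<open>1 - P\<close>; across
  columns \<open>(1 + S) / 2\<close> is the indicator of equal signs.\<close>

lemma adj_mat_eq: "A x y = (Q x y - 2 * P x y + J x y + S x y) / 2"
proof (cases "x \<in> V \<and> y \<in> V \<and> c x \<noteq> c y")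
  case True
  then have "h (m x y) (u x) = 1 \<or> h (m x y) (u x) = - 1" "h (m x y) (u y) = 1 \<or> h (m x y) (u y) = - 1"
    by (simp_all add: m_mem V_mem h_cases)
  then show ?thesis using True
    by (elim disjE) (auto simp: adj_mat_def G_def P_def Q_def S_def ones_mat_def)
qed (auto simp: adj_mat_def G_def P_def Q_def S_def ones_mat_def)

lemma sum_of_bool_mem: "N \<subseteq> V \<Longrightarrow> (\<Sum>z\<in>V. of_bool (z \<in> N)) = real (card N)"
  by (simp add: sum_of_bool_eq Int_absorb1)

lemma sum_adj_mat:
  "(\<Sum>z\<in>V. A x z * b z) = ((\<Sum>z\<in>V. Q x z * b z) - 2 * (\<Sum>z\<in>V. P x z * b z)
      + (\<Sum>z\<in>V. J x z * b z) + (\<Sum>z\<in>V. S x z * b z)) / 2"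
proof -
  have "2 * (\<Sum>z\<in>V. A x z * b z) = (\<Sum>z\<in>V. (Q x z - 2 * P x z + J x z + S x z) * b z)"
    by (simp add: adj_mat_eq sum_distrib_left)
  also have "\<dots> = (\<Sum>z\<in>V. Q x z * b z) - 2 * (\<Sum>z\<in>V. P x z * b z)
      + (\<Sum>z\<in>V. J x z * b z) + (\<Sum>z\<in>V. S x z * b z)"
    by (simp add: algebra_simps sum.distrib sum_subtractf sum_distrib_left)
  finally have "2 * (\<Sum>z\<in>V. A x z * b z) = (\<Sum>z\<in>V. Q x z * b z) - 2 * (\<Sum>z\<in>V. P x z * b z)
      + (\<Sum>z\<in>V. J x z * b z) + (\<Sum>z\<in>V. S x z * b z)" .
  then show ?thesis by simp
qed

section \<open>Products of the basis matrices\<close>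

text \<open>The weight \<open>k\<close> sees only the point of \<open>z\<close>, and
  \<open>q + 1\<close> vertices lie over each point. Different choices of \<open>k\<close> yield the
  products of \<open>P\<close> with \<open>P\<close>, \<open>Q\<close> and \<open>J\<close>.\<close>

lemma sum_P:
  assumes "x \<in> V"
  shows "(\<Sum>z\<in>V. P x z * k (c z) (r z)) = (real q + 1) * k (c x) (r x)"
proof -
  have "(\<Sum>z\<in>V. P x z * k (c z) (r z))
      = (\<Sum>z\<in>V. if c x = c z then if r x = r z then k (c z) (r z) else 0 else 0)"
    using assms by (intro sum.cong) (auto simp: P_def)
  also have "\<dots> = (\<Sum>t\<in>T. \<Sum>s\<in>F. \<Sum>w\<in>U. if c x = t then if r x = s then k t s else 0 else 0)"
    by (rule sum_V)
  also have "\<dots> = (\<Sum>t\<in>T. if c x = t then \<Sum>s\<in>F. if r x = s then \<Sum>w\<in>U. k t s else 0 else 0)"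
    by (intro sum.cong refl) (auto intro!: sum.cong)
  also have "\<dots> = (real q + 1) * k (c x) (r x)"
    using assms fin cards by (simp add: V_mem)
  finally show ?thesis .
qed

lemma sum_Q:
  assumes "x \<in> V"
  shows "(\<Sum>z\<in>V. Q x z * k (c z)) = real q * (real q + 1) * k (c x)"
proof -
  have "(\<Sum>z\<in>V. Q x z * k (c z)) = (\<Sum>z\<in>V. if c x = c z then k (c z) else 0)"
    using assms by (intro sum.cong) (auto simp: Q_def)
  also have "\<dots> = (\<Sum>t\<in>T. \<Sum>s\<in>F. \<Sum>w\<in>U. if c x = t then k t else 0)"
    by (rule sum_V)
  also have "\<dots> = (\<Sum>t\<in>T. if c x = t then \<Sum>s\<in>F. \<Sum>w\<in>U. k t else 0)"
    by (intro sum.cong refl) (auto intro!: sum.cong)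
  also have "\<dots> = real q * (real q + 1) * k (c x)"
    using assms fin cards by (simp add: V_mem)
  finally show ?thesis .
qed

text \<open>Over a fixed point outside the column of \<open>y\<close>, the entries of
  \<open>S\<close> are a multiple of one row of \<open>h\<close>, which sums to zero. Hence the
  products of \<open>P\<close>, \<open>Q\<close> and \<open>J\<close> with \<open>S\<close>
  vanish.\<close>

lemma sum_S:
  assumes "y \<in> V"
  shows "(\<Sum>z\<in>V. k (c z) (r z) * S z y) = 0"
proof -
  let ?s = "\<lambda>t s. sl t s (c y) (r y)"
  have "(\<Sum>z\<in>V. k (c z) (r z) * S z y)
      = (\<Sum>z\<in>V. if c z \<noteq> c y then k (c z) (r z) * h (?s (c z) (r z)) (u y) * h (?s (c z) (r z)) (u z) else 0)"
    using assms by (intro sum.cong) (auto simp: S_def m_def)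
  also have "\<dots> = (\<Sum>t\<in>T. \<Sum>s\<in>F. \<Sum>w\<in>U.
      if t \<noteq> c y then k t s * h (?s t s) (u y) * h (?s t s) w else 0)"
    by (rule sum_V)
  also have "\<dots> = 0"
  proof (rule sum.neutral, rule ballI, rule sum.neutral, rule ballI)
    fix t s assume "t \<in> T" "s \<in> F"
    then show "(\<Sum>w\<in>U. if t \<noteq> c y then k t s * h (?s t s) (u y) * h (?s t s) w else 0) = 0"
      using assms
      by (cases "t = c y") (simp, simp add: sum_distrib_left[symmetric] h_sum sl_mem V_mem del: mult_eq_0_iff)
  qed
  finally show ?thesis .
qed

lemma products_P:
  "(\<Sum>z\<in>V. P x z * P z y) = (real q + 1) * P x y"
  "(\<Sum>z\<in>V. P x z * Q z y) = (real q + 1) * Q x y"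
  "(\<Sum>z\<in>V. P x z * J z y) = (real q + 1) * J x y"
  "(\<Sum>z\<in>V. P x z * S z y) = 0"
proof -
  have neutral: "(\<Sum>z\<in>V. P x z * M z y) = 0" if "x \<notin> V \<or> (\<forall>z\<in>V. M z y = 0)" for M
    using that by (intro sum.neutral) (auto simp: P_def)
  have eqs: "P z y = of_bool (c z = c y \<and> r z = r y)" "Q z y = of_bool (c z = c y)" "J z y = 1"
    if "z \<in> V" "y \<in> V" for z
    using that by (simp_all add: P_def Q_def ones_mat_def)
  show "(\<Sum>z\<in>V. P x z * P z y) = (real q + 1) * P x y"
    using sum_P[of x "\<lambda>t s. of_bool (t = c y \<and> s = r y)"]
    by (cases "x \<in> V \<and> y \<in> V") (auto simp: eqs neutral, auto simp: P_def)
  show "(\<Sum>z\<in>V. P x z * Q z y) = (real q + 1) * Q x y"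
    using sum_P[of x "\<lambda>t s. of_bool (t = c y)"]
    by (cases "x \<in> V \<and> y \<in> V") (auto simp: eqs neutral, auto simp: Q_def)
  show "(\<Sum>z\<in>V. P x z * J z y) = (real q + 1) * J x y"
    using sum_P[of x "\<lambda>t s. 1"]
    by (cases "x \<in> V \<and> y \<in> V") (auto simp: eqs neutral, auto simp: ones_mat_def)
  show "(\<Sum>z\<in>V. P x z * S z y) = 0"
    using sum_S[of y "\<lambda>t s. of_bool (c x = t \<and> r x = s)"]
    by (cases "x \<in> V \<and> y \<in> V") (auto simp: P_def S_def)
qed


lemma products_Q:
  "(\<Sum>z\<in>V. Q x z * P z y) = (real q + 1) * Q x y"
  "(\<Sum>z\<in>V. Q x z * Q z y) = real q * (real q + 1) * Q x y"
  "(\<Sum>z\<in>V. Q x z * J z y) = real q * (real q + 1) * J x y"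
  "(\<Sum>z\<in>V. Q x z * S z y) = 0"
proof -
  have neutral: "(\<Sum>z\<in>V. Q x z * M z y) = 0" if "x \<notin> V \<or> (\<forall>z\<in>V. M z y = 0)" for M
    using that by (intro sum.neutral) (auto simp: Q_def)
  have eqs: "Q z y = of_bool (c z = c y)" "J z y = 1" if "z \<in> V" "y \<in> V" for z
    using that by (simp_all add: Q_def ones_mat_def)
  \<comment> \<open>All the matrices are symmetric, so this product is the transpose of one already
    known.\<close>
  show "(\<Sum>z\<in>V. Q x z * P z y) = (real q + 1) * Q x y"
    using products_P(2)[of y x] by (simp add: sym[of x] sym[of _ y] mult.commute)
  show "(\<Sum>z\<in>V. Q x z * Q z y) = real q * (real q + 1) * Q x y"
    using sum_Q[of x "\<lambda>t. of_bool (t = c y)"]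
    by (cases "x \<in> V \<and> y \<in> V") (auto simp: eqs neutral, auto simp: Q_def)
  show "(\<Sum>z\<in>V. Q x z * J z y) = real q * (real q + 1) * J x y"
    using sum_Q[of x "\<lambda>t. 1"]
    by (cases "x \<in> V \<and> y \<in> V") (auto simp: eqs neutral, auto simp: ones_mat_def)
  show "(\<Sum>z\<in>V. Q x z * S z y) = 0"
    using sum_S[of y "\<lambda>t s. of_bool (c x = t)"]
    by (cases "x \<in> V \<and> y \<in> V") (auto simp: Q_def S_def)
qed

lemma products_J:
  "(\<Sum>z\<in>V. J x z * P z y) = (real q + 1) * J x y"
  "(\<Sum>z\<in>V. J x z * Q z y) = real q * (real q + 1) * J x y"
  "(\<Sum>z\<in>V. J x z * J z y) = real (card V) * J x y"
  "(\<Sum>z\<in>V. J x z * S z y) = 0"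
proof -
  show "(\<Sum>z\<in>V. J x z * P z y) = (real q + 1) * J x y"
    using products_P(3)[of y x] by (simp add: sym[of x] sym[of _ y] mult.commute)
  show "(\<Sum>z\<in>V. J x z * Q z y) = real q * (real q + 1) * J x y"
    using products_Q(3)[of y x] by (simp add: sym[of x] sym[of _ y] mult.commute)
  show "(\<Sum>z\<in>V. J x z * J z y) = real (card V) * J x y"
    by (simp add: ones_mat_def)
  show "(\<Sum>z\<in>V. J x z * S z y) = 0"
    using sum_S[of y "\<lambda>t s. 1"]
    by (cases "x \<in> V \<and> y \<in> V") (auto simp: ones_mat_def S_def)
qed

lemma h_orthogonality:
  "\<lbrakk>k \<in> F; k' \<in> F\<rbrakk> \<Longrightarrow> (\<Sum>w\<in>U. h k w * h k' w) = (if k = k' then real q + 1 else 0)"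
  using h_orth[of k k'] by (auto simp: h_square cards)

lemma h_column_products:
  "\<lbrakk>w \<in> U; w' \<in> U\<rbrakk> \<Longrightarrow> (\<Sum>k\<in>F. h k w * h k w') = (if w = w' then real q else - 1)"
  using h_cols[of w w'] by (auto simp: h_square cards)

text \<open>This is the part of the entry of \<open>S\<close> squared at \<open>x\<close>,
  \<open>y\<close> that comes from one column \<open>t\<close>. Row orthogonality keeps only the
  points \<open>(t, s)\<close> joined to \<open>x\<close> and \<open>y\<close> by equal slopes: all
  of them if \<open>x\<close> and \<open>y\<close> share a point, none if they share just the
  column, and exactly one otherwise.\<close>

lemma sum_column_S_S:
  assumes x: "x \<in> V" and y: "y \<in> V" and t: "t \<in> T" "t \<noteq> c x" "t \<noteq> c y"
  defines "a \<equiv> sl (c x) (r x) t" and "b \<equiv> sl (c y) (r y) t"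
  shows "(\<Sum>s\<in>F. \<Sum>w\<in>U. (h (a s) (u x) * h (a s) w) * (h (b s) (u y) * h (b s) w))
    = (real q + 1) * (if c x = c y then (real q + 1) * I x y - P x y else S x y)"
proof -
  have mem: "a s \<in> F" "b s \<in> F" if "s \<in> F" for s
    using that x y t by (auto simp: a_def b_def sl_mem V_mem)
  have bij_a: "bij_betw a F F" unfolding a_def using x t by (intro sl_bij V_mem) auto
  have "(\<Sum>s\<in>F. \<Sum>w\<in>U. (h (a s) (u x) * h (a s) w) * (h (b s) (u y) * h (b s) w))
      = (\<Sum>s\<in>F. h (a s) (u x) * h (b s) (u y) * (\<Sum>w\<in>U. h (a s) w * h (b s) w))"
    by (simp add: sum_distrib_left mult_ac)
  also have "\<dots> = (\<Sum>s\<in>F. (real q + 1) * (if a s = b s then h (a s) (u x) * h (a s) (u y) else 0))"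
    by (intro sum.cong refl) (auto simp: h_orthogonality mem)
  also have "\<dots> = (real q + 1) * (\<Sum>s\<in>F. if a s = b s then h (a s) (u x) * h (a s) (u y) else 0)"
    by (simp add: sum_distrib_left)
  also have "(\<Sum>s\<in>F. if a s = b s then h (a s) (u x) * h (a s) (u y) else 0)
      = (if c x = c y then (real q + 1) * I x y - P x y else S x y)"
  proof (cases "c x = c y")
    case True
    show ?thesis
    proof (cases "r x = r y")
      case True
      then have "(\<Sum>s\<in>F. if a s = b s then h (a s) (u x) * h (a s) (u y) else 0)
          = (\<Sum>s\<in>F. h (a s) (u x) * h (a s) (u y))"
        using \<open>c x = c y\<close> by (simp add: a_def b_def)
      also have "\<dots> = (\<Sum>k\<in>F. h k (u x) * h k (u y))"
        by (rule sum.reindex_bij_betw[OF bij_a])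
      also have "\<dots> = (if u x = u y then real q else - 1)"
        using x y by (intro h_column_products V_mem)
      also have "\<dots> = (real q + 1) * I x y - P x y"
        using True \<open>c x = c y\<close> x y V_eqI[of x y] by (auto simp: id_mat_def P_def)
      finally show ?thesis using \<open>c x = c y\<close> by simp
    next
      case False
      \<comment> \<open>Lines of equal slope through \<open>(t, s)\<close> coincide, so they meet
        the column of \<open>x\<close> in the same point.\<close>
      have "a s \<noteq> b s" if s: "s \<in> F" for s
      proof
        assume "a s = b s"
        then have "sl t s (c x) (r x) = sl t s (c x) (r y)"
          using sl_sym[of "c x" t "r x" s] sl_sym[of "c x" t "r y" s] x y t s \<open>c x = c y\<close>
          by (auto simp: a_def b_def V_mem)
        moreover have "inj_on (sl t s (c x)) F"
          using sl_bij[of t "c x" s] x t s by (auto simp: V_mem bij_betw_def)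
        ultimately show False using False x y by (auto simp: inj_on_def V_mem)
      qed
      moreover have "I x y = 0" "P x y = 0" using False by (auto simp: id_mat_def P_def)
      ultimately show ?thesis using \<open>c x = c y\<close> by simp
    qed
  next
    case False
    have "a s = b s \<longleftrightarrow> a s = m x y" if "s \<in> F" for s
      unfolding a_def b_def m_def using x y t that False by (intro sl_eq_iff V_mem) auto
    then have "(\<Sum>s\<in>F. if a s = b s then h (a s) (u x) * h (a s) (u y) else 0)
        = (\<Sum>s\<in>F. if a s = m x y then h (m x y) (u x) * h (m x y) (u y) else 0)"
      by (intro sum.cong refl) auto
    also have "\<dots> = (\<Sum>k\<in>F. if k = m x y then h (m x y) (u x) * h (m x y) (u y) else 0)"
      by (rule sum.reindex_bij_betw[OF bij_a])
    also have "\<dots> = S x y" using fin x y False m_mem[OF x y False] by (simp add: S_def)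
    finally show ?thesis using False by simp
  qed
  finally show ?thesis .
qed

lemma products_S:
  "(\<Sum>z\<in>V. S x z * P z y) = 0"
  "(\<Sum>z\<in>V. S x z * Q z y) = 0"
  "(\<Sum>z\<in>V. S x z * J z y) = 0"
  "(\<Sum>z\<in>V. S x z * S z y) = (real q - 3) * (real q + 1)\<^sup>2 * I x y
     - (real q - 3) * (real q + 1) * P x y + (real q - 4) * (real q + 1) * S x y"
proof -
  show "(\<Sum>z\<in>V. S x z * P z y) = 0"
    using products_P(4)[of y x] by (simp add: sym[of x] sym[of _ y] mult.commute)
  show "(\<Sum>z\<in>V. S x z * Q z y) = 0"
    using products_Q(4)[of y x] by (simp add: sym[of x] sym[of _ y] mult.commute)
  show "(\<Sum>z\<in>V. S x z * J z y) = 0"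
    using products_J(4)[of y x] by (simp add: sym[of x] sym[of _ y] mult.commute)
  show "(\<Sum>z\<in>V. S x z * S z y) = (real q - 3) * (real q + 1)\<^sup>2 * I x y
     - (real q - 3) * (real q + 1) * P x y + (real q - 4) * (real q + 1) * S x y"
  proof (cases "x \<in> V \<and> y \<in> V")
    case True
    then have x: "x \<in> V" and y: "y \<in> V" by auto
    let ?e = "if c x = c y then (real q + 1) * I x y - P x y else S x y"
    define a where "a = sl (c x) (r x)"
    define b where "b = sl (c y) (r y)"
    have S_S: "(\<Sum>z\<in>V. S x z * S z y) = (\<Sum>z\<in>V. S x z * S y z)"
      by (intro sum.cong refl) (simp add: sym(5))
    have "(\<Sum>z\<in>V. S x z * S z y) = (\<Sum>z\<in>V. if c z \<noteq> c x \<and> c z \<noteq> c y then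
        (h (a (c z) (r z)) (u x) * h (a (c z) (r z)) (u z))
         * (h (b (c z) (r z)) (u y) * h (b (c z) (r z)) (u z)) else 0)"
      unfolding S_S using x y by (intro sum.cong refl) (auto simp: S_def m_def a_def b_def)
    also have "\<dots> = (\<Sum>t\<in>T. \<Sum>s\<in>F. \<Sum>w\<in>U. if t \<noteq> c x \<and> t \<noteq> c y then
        (h (a t s) (u x) * h (a t s) w) * (h (b t s) (u y) * h (b t s) w) else 0)"
      by (rule sum_V)
    also have "\<dots> = (\<Sum>t\<in>T. if t \<noteq> c x \<and> t \<noteq> c y then (real q + 1) * ?e else 0)"
      using sum_column_S_S[OF x y]
      by (intro sum.cong refl) (simp add: a_def b_def)
    also have "\<dots> = (\<Sum>t\<in>T - {c x, c y}. (real q + 1) * ?e)"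
      using fin by (intro sum.mono_neutral_cong_right) auto
    also have "\<dots> = real (card (T - {c x, c y})) * ((real q + 1) * ?e)" by simp
    \<comment> \<open>Of the \<open>q - 2\<close> columns, one or two are excluded, according to
      whether \<open>x\<close> and \<open>y\<close> share a column.\<close>
    also have "card (T - {c x, c y}) = (if c x = c y then q - 3 else q - 4)"
      using x y fin cards by (auto simp: card_Diff_subset V_mem)
    also have "real (if c x = c y then q - 3 else q - 4) * ((real q + 1) * ?e)
      = (real q - 3) * (real q + 1)\<^sup>2 * I x y
         - (real q - 3) * (real q + 1) * P x y + (real q - 4) * (real q + 1) * S x y"
      using cards by (auto simp: S_def P_def id_mat_def power2_eq_square algebra_simps)
    finally show ?thesis .
  next
    case False
    then show ?thesis by (auto simp: S_def P_def id_mat_def intro!: sum.neutral)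
  qed
qed

text \<open>Expands the square of \<open>Q - 2 P + J + S\<close> by the product formulas; the number
  of vertices enters through \<open>J J\<close>. Valency, common neighbours of edges and the
  separation of the two kinds of non-edges are all read off here.\<close>

lemma adj_mat_square:
  "(\<Sum>z\<in>V. A x z * A z y) = (real q + 1) / 4 *
     ((real q - 4) * Q x y + (7 - real q) * P x y + ((real q)\<^sup>2 - 4) * J x y
      + (real q - 3) * (real q + 1) * I x y + (real q - 4) * S x y)"
proof -
  let ?c = "\<lambda>M N. \<Sum>z\<in>V. M x z * N z y :: real"
  have "4 * (\<Sum>z\<in>V. A x z * A z y)
     = (\<Sum>z\<in>V. (Q x z - 2 * P x z + J x z + S x z) * (Q z y - 2 * P z y + J z y + S z y))"
    by (simp add: adj_mat_eq sum_distrib_left)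
  also have "\<dots> = ?c Q Q - 2 * ?c Q P + ?c Q J + ?c Q S
      - 2 * ?c P Q + 4 * ?c P P - 2 * ?c P J - 2 * ?c P S
      + ?c J Q - 2 * ?c J P + ?c J J + ?c J S
      + ?c S Q - 2 * ?c S P + ?c S J + ?c S S"
    by (simp add: algebra_simps sum.distrib sum_subtractf sum_distrib_left)
  also have "\<dots> = (real q + 1) *
     ((real q - 4) * Q x y + (7 - real q) * P x y + ((real q)\<^sup>2 - 4) * J x y
      + (real q - 3) * (real q + 1) * I x y + (real q - 4) * S x y)"
    unfolding products_P products_Q products_J products_S real_card_V
    by (simp add: power2_eq_square algebra_simps)
  finally show ?thesis by simp
qed


section \<open>Neumaier parameters\<close>

lemma pair_graph_G: "pair_graph G"
proof unfold_locales
  have "parcs G \<subseteq> V \<times> V" by (auto simp: G_def)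
  then show "finite (parcs G)" by (rule finite_subset) simp
  show "symmetric (with_proj G)"
    unfolding symmetric_def with_proj_simps
  proof (rule symI)
    fix x y assume xy: "(x, y) \<in> parcs G"
    show "(y, x) \<in> parcs G"
    proof (cases "c x = c y")
      case False
      then show ?thesis using xy m_sym[of x y] by (simp add: G_def)
    qed (use xy in \<open>auto simp: G_def\<close>)
  qed
qed (auto simp: G_def)

lemma card_common_neighbours:
  "real (card (neighbours G x \<inter> neighbours G y)) = (\<Sum>z\<in>V. A x z * A z y)"
proof -
  have A_sym: "A z y = A y z" for z by (simp add: adj_mat_eq sym[of z])
  have "(\<Sum>z\<in>V. A x z * A z y) = (\<Sum>z\<in>V. of_bool (z \<in> neighbours G x \<inter> neighbours G y))"
    unfolding A_sym by (intro sum.cong refl) (auto simp: adj_mat_def neighbours_def)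
  also have "\<dots> = real (card (neighbours G x \<inter> neighbours G y))"
    by (rule sum_of_bool_mem) (auto simp: neighbours_def)
  finally show ?thesis by simp
qed

text \<open>On edges \<open>S = 1 - Q\<close>, and in the squared adjacency matrix \<open>Q\<close>
  and \<open>S\<close> have the same coefficient, proportional to \<open>q - 4\<close>. Their
  contributions therefore add up to a constant, whatever the kind of edge.\<close>

lemma edge_regular_G:
  "edge_regular G ((q + 1) * q * (q - 2)) ((q + 1)\<^sup>2 * (q - 2) div 2) ((q + 1) * (q\<^sup>2 + q - 8) div 4)"
  unfolding edge_regular_def
proof (intro conjI ballI impI)
  show "pair_graph G" by (rule pair_graph_G)
  show "card (pverts G) = (q + 1) * q * (q - 2)" by (simp add: card_V mult_ac)
next
  fix x assume "x \<in> pverts G"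
  then have x: "x \<in> V" by simp
  \<comment> \<open>The valency is a diagonal entry of the squared adjacency matrix.\<close>
  have "real (card (neighbours G x)) = (\<Sum>z\<in>V. A x z * A z x)"
    using card_common_neighbours[of x x] by simp
  also have "\<dots> = (real q + 1)\<^sup>2 * (real q - 2) / 2"
    unfolding adj_mat_square using x
    by (simp add: Q_def P_def S_def id_mat_def ones_mat_def power2_eq_square field_simps)
  finally have "real (2 * card (neighbours G x)) = real ((q + 1)\<^sup>2 * (q - 2))"
    by (simp add: real_q_minus_2 add.commute)
  then have "2 * card (neighbours G x) = (q + 1)\<^sup>2 * (q - 2)" by (simp only: of_nat_eq_iff)
  then show "card (neighbours G x) = (q + 1)\<^sup>2 * (q - 2) div 2" by linarith
next
  fix x y assume "x \<in> pverts G" "y \<in> pverts G" and xy: "(x, y) \<in> parcs G"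
  then have x: "x \<in> V" and y: "y \<in> V" by auto
  have "A x y = 1" using xy by (simp add: adj_mat_def)
  have "\<not> (c x = c y \<and> r x = r y)" using xy by (auto simp: G_def)
  then have PIJ: "P x y = 0" "I x y = 0" "J x y = 1"
    using x y by (auto simp: P_def id_mat_def ones_mat_def)
  have S: "S x y = 1 - Q x y"
    using adj_mat_eq[of x y] \<open>A x y = 1\<close> by (simp add: PIJ)
  have "real (card (neighbours G x \<inter> neighbours G y)) = (\<Sum>z\<in>V. A x z * A z y)"
    by (rule card_common_neighbours)
  also have "\<dots> = (real q + 1) * ((real q)\<^sup>2 + real q - 8) / 4"
    unfolding adj_mat_square S PIJ by (simp add: field_simps power2_eq_square)
  finally have "real (4 * card (neighbours G x \<inter> neighbours G y)) = (real q + 1) * ((real q)\<^sup>2 + real q - 8)"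
    by simp
  also have "\<dots> = real ((q + 1) * (q\<^sup>2 + q - 8))"
  proof -
    have "q\<^sup>2 \<ge> 7\<^sup>2" using cards by (intro power_mono) auto
    then have ge: "q\<^sup>2 + q \<ge> 8" by simp
    show ?thesis unfolding of_nat_mult of_nat_diff[OF ge] by simp
  qed
  finally have "4 * card (neighbours G x \<inter> neighbours G y) = (q + 1) * (q\<^sup>2 + q - 8)"
    by (simp only: of_nat_eq_iff)
  then show "card (neighbours G x \<inter> neighbours G y) = (q + 1) * (q\<^sup>2 + q - 8) div 4"
    by linarith
qed

text \<open>Neighbours in \<open>C\<close> are counted by a row sum of \<open>A\<close> over
  \<open>C\<close>. For \<open>x\<close> outside \<open>C\<close> the corresponding sums of
  \<open>Q\<close>, \<open>P\<close>, \<open>J\<close> and \<open>S\<close> are \<open>q\<close>,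
  \<open>1\<close>, \<open>q (q - 2)\<close> and \<open>- (q - 3)\<close>, and half of
  \<open>Q - 2 P + J + S\<close> gives \<open>(q - 1)^2 / 2\<close>.\<close>

lemma regular_clique_G:
  assumes u0: "u0 \<in> U"
  defines "C \<equiv> {x \<in> V. u x = u0}"
  shows "regular_clique G ((q - 1)\<^sup>2 div 2) C" "card C = q * (q - 2)"
proof -
  have sum_C: "(\<Sum>z\<in>V. f (c z) (r z) * of_bool (u z = u0)) = (\<Sum>t\<in>T. \<Sum>s\<in>F. f t s)" for f :: "'t \<Rightarrow> 'f \<Rightarrow> real"
  proof -
    have "(\<Sum>w\<in>U. f t s * of_bool (w = u0)) = f t s" for t s
      using u0 fin by (simp add: sum_distrib_left[symmetric] of_bool_def)
    then show ?thesis using sum_V[of "\<lambda>t s w. f t s * of_bool (w = u0)"] by simp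
  qed
  have "real (card C) = (\<Sum>z\<in>V. of_bool (z \<in> C))"
    by (rule sum_of_bool_mem[symmetric]) (auto simp: C_def)
  also have "\<dots> = (\<Sum>z\<in>V. 1 * of_bool (u z = u0))" by (intro sum.cong) (auto simp: C_def)
  also have "\<dots> = real (q * (q - 2))" using sum_C[of "\<lambda>_ _. 1"] by (simp add: cards)
  finally show "card C = q * (q - 2)" by (simp only: of_nat_eq_iff)
  have deg: "card (neighbours G x \<inter> C) = (q - 1)\<^sup>2 div 2" if "x \<in> pverts G - C" for x
  proof -
    from that have x: "x \<in> V" "u x \<noteq> u0" by (auto simp: C_def)
    let ?b = "\<lambda>z. of_bool (u z = u0) :: real"
    let ?s = "sl (c x) (r x)"
    have P: "(\<Sum>z\<in>V. P x z * ?b z) = 1"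
    proof -
      have "(\<Sum>z\<in>V. P x z * ?b z) = (\<Sum>z\<in>V. of_bool (c x = c z \<and> r x = r z) * ?b z)"
        using x by (intro sum.cong) (auto simp: P_def)
      also have "\<dots> = (\<Sum>t\<in>T. \<Sum>s\<in>F. of_bool (c x = t \<and> r x = s))" by (rule sum_C)
      also have "\<dots> = (\<Sum>t\<in>T. if c x = t then \<Sum>s\<in>F. if r x = s then 1 else 0 else 0)"
        by (intro sum.cong refl) (auto intro!: sum.cong)
      also have "\<dots> = 1" using x fin by (simp add: V_mem)
      finally show ?thesis .
    qed
    have Q: "(\<Sum>z\<in>V. Q x z * ?b z) = real q"
    proof -
      have "(\<Sum>z\<in>V. Q x z * ?b z) = (\<Sum>z\<in>V. of_bool (c x = c z) * ?b z)"
        using x by (intro sum.cong) (auto simp: Q_def)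
      also have "\<dots> = (\<Sum>t\<in>T. \<Sum>s\<in>F. of_bool (c x = t))" by (rule sum_C)
      also have "\<dots> = real q" using x fin cards by (simp add: V_mem of_bool_def if_distrib cong: if_cong)
      finally show ?thesis .
    qed
    have J: "(\<Sum>z\<in>V. J x z * ?b z) = real q * (real q - 2)"
    proof -
      have "(\<Sum>z\<in>V. J x z * ?b z) = (\<Sum>z\<in>V. 1 * ?b z)"
        using x by (intro sum.cong) (auto simp: ones_mat_def)
      also have "\<dots> = (\<Sum>t\<in>T. \<Sum>s\<in>F. 1)" by (rule sum_C)
      also have "\<dots> = real q * (real q - 2)" using cards real_q_minus_2 by simp
      finally show ?thesis .
    qed
    \<comment> \<open>In each of the \<open>q - 3\<close> columns other than that of
      \<open>x\<close> the slope runs once through \<open>F\<close>, and \<open>h_cols\<close>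
      contributes \<open>- 1\<close>, as \<open>u x\<close> differs from \<open>u0\<close>.\<close>
    have S: "(\<Sum>z\<in>V. S x z * ?b z) = - (real q - 3)"
    proof -
      have "(\<Sum>z\<in>V. S x z * ?b z)
          = (\<Sum>z\<in>V. (if c z \<noteq> c x then h (?s (c z) (r z)) (u x) * h (?s (c z) (r z)) u0 else 0) * ?b z)"
        using x by (intro sum.cong) (auto simp: S_def m_def)
      also have "\<dots> = (\<Sum>t\<in>T. \<Sum>s\<in>F. if t \<noteq> c x then h (?s t s) (u x) * h (?s t s) u0 else 0)"
        by (rule sum_C)
      also have "\<dots> = (\<Sum>t\<in>T. if t \<noteq> c x then - 1 else 0)"
      proof (rule sum.cong[OF refl])
        fix t assume t: "t \<in> T"
        have "(\<Sum>s\<in>F. h (?s t s) (u x) * h (?s t s) u0) = - 1" if "t \<noteq> c x"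
        proof -
          have "bij_betw (?s t) F F" using x t that by (intro sl_bij V_mem) auto
          then have "(\<Sum>s\<in>F. h (?s t s) (u x) * h (?s t s) u0) = (\<Sum>k\<in>F. h k (u x) * h k u0)"
            by (rule sum.reindex_bij_betw)
          also have "\<dots> = - 1" using x u0 by (intro h_cols V_mem)
          finally show ?thesis .
        qed
        then show "(\<Sum>s\<in>F. if t \<noteq> c x then h (?s t s) (u x) * h (?s t s) u0 else 0)
          = (if t \<noteq> c x then - 1 else 0)" by simp
      qed
      also have "\<dots> = (\<Sum>t\<in>T - {c x}. - 1)"
        using fin by (intro sum.mono_neutral_cong_right) auto
      also have "\<dots> = - (real q - 3)" using x fin cards by (simp add: V_mem of_nat_diff)
      finally show ?thesis .
    qed
    have "real (card (neighbours G x \<inter> C)) = (\<Sum>z\<in>V. of_bool (z \<in> neighbours G x \<inter> C))"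
      by (rule sum_of_bool_mem[symmetric]) (auto simp: C_def)
    also have "\<dots> = (\<Sum>z\<in>V. A x z * ?b z)"
      by (intro sum.cong) (auto simp: C_def neighbours_def adj_mat_def)
    also have "\<dots> = ((\<Sum>z\<in>V. Q x z * ?b z) - 2 * (\<Sum>z\<in>V. P x z * ?b z)
        + (\<Sum>z\<in>V. J x z * ?b z) + (\<Sum>z\<in>V. S x z * ?b z)) / 2"
      by (rule sum_adj_mat)
    also have "\<dots> = (real q - 1)\<^sup>2 / 2"
      unfolding P Q J S by (simp add: power2_eq_square algebra_simps)
    finally have "real (2 * card (neighbours G x \<inter> C)) = real ((q - 1)\<^sup>2)"
      using cards by (simp add: of_nat_diff)
    then have "2 * card (neighbours G x \<inter> C) = (q - 1)\<^sup>2" by (simp only: of_nat_eq_iff)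
    then show ?thesis by linarith
  qed
  have "C \<noteq> {}" using \<open>card C = q * (q - 2)\<close> cards by auto
  moreover have "C \<noteq> pverts G"
  proof -
    obtain w where w: "w \<in> U" "w \<noteq> u0" by (rule card_gt_1_obtain_other[OF card_gt_1(3)])
    obtain t s where "t \<in> T" "s \<in> F" using not_empty by blast
    from V_ex[OF this w(1)] obtain x where "x \<in> V" "u x = w" by blast
    with w(2) have "x \<in> V" "x \<notin> C" by (auto simp: C_def)
    then have "C \<noteq> V" by blast
    then show ?thesis by simp
  qed
  moreover have "(q - 1)\<^sup>2 div 2 > 0"
  proof -
    have "(q - 1)\<^sup>2 \<ge> 2\<^sup>2" using cards by (intro power_mono) auto
    then show ?thesis by simp
  qed
  moreover have "clique G C"
    unfolding clique_def by (auto simp: C_def G_def intro: V_eqI)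
  ultimately show "regular_clique G ((q - 1)\<^sup>2 div 2) C"
    unfolding regular_clique_def using deg by blast
qed


lemma neumaier_G:
  "neumaier_graph G ((q + 1) * q * (q - 2)) ((q + 1)\<^sup>2 * (q - 2) div 2)
     ((q + 1) * (q\<^sup>2 + q - 8) div 4) ((q - 1)\<^sup>2 div 2) (q * (q - 2))"
proof -
  \<comment> \<open>Two vertices over one point are not adjacent, so the graph is not
    complete.\<close>
  obtain t s w where tsw: "t \<in> T" "s \<in> F" "w \<in> U" using not_empty by blast
  obtain w' where w': "w' \<in> U" "w' \<noteq> w" by (rule card_gt_1_obtain_other[OF card_gt_1(3)])
  then obtain x y where xy: "x \<in> V" "y \<in> V" "c x = c y" "r x = r y" "u x \<noteq> u y"
    using V_ex[OF tsw] V_ex[OF tsw(1,2) w'(1)] w'(2) by auto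
  then have "(x, y) \<notin> parcs G" "x \<noteq> y" by (auto simp: G_def)
  then have "\<not> complete_digraph v (with_proj G)" for v
    using xy by (auto simp: complete_digraph_pair_def)
  then show ?thesis
    unfolding neumaier_graph_def using edge_regular_G regular_clique_G[OF tsw(3)] by blast
qed

section \<open>Coherent closure and rank\<close>

abbreviation "B \<equiv> {S, I, P, Q, J}"

lemma B_mats_on: "B \<subseteq> mats_on V"
  by (auto simp: mats_on_def P_def Q_def S_def id_mat_def ones_mat_def)

lemma mult_mat_table:
  "mult_mat V P P = scale_mat (real q + 1) P"
  "mult_mat V P Q = scale_mat (real q + 1) Q"
  "mult_mat V P J = scale_mat (real q + 1) J"
  "mult_mat V P S = 0"
  "mult_mat V Q P = scale_mat (real q + 1) Q"
  "mult_mat V Q Q = scale_mat (real q * (real q + 1)) Q"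
  "mult_mat V Q J = scale_mat (real q * (real q + 1)) J"
  "mult_mat V Q S = 0"
  "mult_mat V J P = scale_mat (real q + 1) J"
  "mult_mat V J Q = scale_mat (real q * (real q + 1)) J"
  "mult_mat V J J = scale_mat (real (card V)) J"
  "mult_mat V J S = 0"
  "mult_mat V S P = 0"
  "mult_mat V S Q = 0"
  "mult_mat V S J = 0"
  "mult_mat V S S = scale_mat ((real q - 3) * (real q + 1)\<^sup>2) I
     - scale_mat ((real q - 3) * (real q + 1)) P + scale_mat ((real q - 4) * (real q + 1)) S"
  unfolding mult_mat_def scale_mat_def products_P products_Q products_J products_S
  by (simp_all add: fun_eq_iff)

text \<open>On \<open>V\<close>, the entries of \<open>S\<close> are signs exactly where
  \<open>Q\<close> vanishes, which gives \<open>J - Q\<close> for its entrywise square; the other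
  products compare nested or disjoint supports.\<close>

lemma entrywise_mult_table:
  "entrywise_mult I P = I" "entrywise_mult I Q = I" "entrywise_mult I J = I"
  "entrywise_mult P Q = P" "entrywise_mult P J = P" "entrywise_mult Q J = Q"
  "entrywise_mult I S = 0" "entrywise_mult P S = 0" "entrywise_mult Q S = 0"
  "entrywise_mult J S = S" "entrywise_mult S S = J - Q"
  "entrywise_mult I I = I" "entrywise_mult P P = P" "entrywise_mult Q Q = Q" "entrywise_mult J J = J"
proof -
  have "S x y * S x y = J x y - Q x y" for x y
  proof (cases "x \<in> V \<and> y \<in> V \<and> c x \<noteq> c y")
    case True
    then have "h (m x y) (u x) = 1 \<or> h (m x y) (u x) = - 1" "h (m x y) (u y) = 1 \<or> h (m x y) (u y) = - 1"
      by (simp_all add: m_mem V_mem h_cases)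
    with True show ?thesis by (auto simp: S_def ones_mat_def Q_def)
  qed (auto simp: S_def ones_mat_def Q_def)
  then show "entrywise_mult S S = J - Q" by (simp add: entrywise_mult_def fun_eq_iff)
qed (auto simp: entrywise_mult_def fun_eq_iff id_mat_def P_def Q_def S_def ones_mat_def)

text \<open>Both products are bilinear, so the two tables settle them; transposition fixes every
  matrix in the span, since the generators are symmetric.\<close>

lemma coherent_algebra_span_B: "coherent_algebra V (rmat.span B)"
  unfolding coherent_algebra_def
proof (intro conjI ballI)
  have in_span: "I \<in> rmat.span B" "P \<in> rmat.span B" "Q \<in> rmat.span B" "J \<in> rmat.span B" "S \<in> rmat.span B"
    by (simp_all add: rmat.span_base)
  note span = in_span rmat.span_zero rmat.span_add rmat.span_diff rmat.span_scale
  show "rmat.span B \<subseteq> mats_on V"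
    using B_mats_on coherent_algebra_mats_on[of V] by (intro rmat.span_minimal) (auto simp: coherent_algebra_def)
  show "rmat.subspace (rmat.span B)" by (rule rmat.subspace_span)
  show "I \<in> rmat.span B" "J \<in> rmat.span B" by (rule in_span)+
  show "transp_mat M \<in> rmat.span B" if "M \<in> rmat.span B" for M
  proof -
    have "transp_mat M = M"
      using that
    proof (rule rmat.span_induct)
      show "rmat.subspace {M. transp_mat M = M}"
        by (auto simp: rmat.subspace_def transp_mat_def scale_mat_def fun_eq_iff)
    qed (auto simp: transp_mat_def fun_eq_iff sym)
    with that show ?thesis by simp
  qed
  fix M N assume MN: "M \<in> rmat.span B" "N \<in> rmat.span B"
  show "mult_mat V M N \<in> rmat.span B"
  proof (rule span_closed_bilinear[OF _ _ _ _ _ MN])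
    fix M N assume "M \<in> B" "N \<in> B"
    moreover from this have "M \<in> mats_on V" "N \<in> mats_on V" using B_mats_on by auto
    ultimately show "mult_mat V M N \<in> rmat.span B"
      by (auto simp: mult_id_mat mult_mat_table span)
  qed (auto simp: mult_mat_def scale_mat_def fun_eq_iff algebra_simps sum.distrib sum_distrib_left)
  show "entrywise_mult M N \<in> rmat.span B"
  proof (rule span_closed_bilinear[OF _ _ _ _ _ MN])
    have comm: "entrywise_mult M N = entrywise_mult N M" for M N :: "'v rmat"
      by (simp add: entrywise_mult_def fun_eq_iff mult.commute)
    fix M N assume "M \<in> B" "N \<in> B"
    then show "entrywise_mult M N \<in> rmat.span B"
      by (auto simp: entrywise_mult_table comm[of P I] comm[of Q I] comm[of J I] comm[of S I]
          comm[of Q P] comm[of J P] comm[of S P] comm[of J Q] comm[of S Q] comm[of S J] span)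
  qed (auto simp: entrywise_mult_def scale_mat_def fun_eq_iff algebra_simps)
qed

text \<open>In the other direction, \<open>J - I - A\<close> is the sum of \<open>P - I\<close> and a matrix with disjoint support on
  which \<open>A\<^sup>2\<close> takes a different value; this isolates \<open>P\<close>.\<close>

lemma coherent_closure_G: "coherent_closure G = rmat.span B"
proof
  have "A = scale_mat (1 / 2) (Q - scale_mat 2 P + J + S)"
    by (simp add: fun_eq_iff scale_mat_def adj_mat_eq)
  also have "\<dots> \<in> rmat.span B"
    by (intro rmat.span_scale rmat.span_add rmat.span_diff rmat.span_base) auto
  finally show "coherent_closure G \<subseteq> rmat.span B"
    using coherent_closure_least(3)[OF pair_graph_G] coherent_algebra_span_B by simp
  let ?C = "coherent_closure G"
  have alg: "coherent_algebra V ?C" and A: "A \<in> ?C"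
    using coherent_closure_least(1,2)[OF pair_graph_G] by simp_all
  then have sub: "rmat.subspace ?C" and I: "I \<in> ?C" and J: "J \<in> ?C"
    and mult: "\<And>M N. M \<in> ?C \<Longrightarrow> N \<in> ?C \<Longrightarrow> mult_mat V M N \<in> ?C"
    and entry: "\<And>M N. M \<in> ?C \<Longrightarrow> N \<in> ?C \<Longrightarrow> entrywise_mult M N \<in> ?C"
    by (auto simp: coherent_algebra_def)
  note closed = rmat.subspace_add[OF sub] rmat.subspace_diff[OF sub] rmat.subspace_scale[OF sub] mult entry
  \<comment> \<open>On the support of \<open>J - I - A\<close>, the squared adjacency matrix is
    \<open>(q + 1)^2 (q - 1) / 4\<close> for pairs over one point and
    \<open>q (q + 1) (q - 1) / 4\<close> otherwise. The scalar normalises these values to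
    \<open>q + 1\<close> and \<open>q\<close>, so subtracting \<open>q\<close> leaves the indicator
    of \<open>P - I\<close>.\<close>
  have "P = I + scale_mat (4 / ((real q + 1) * (real q - 1))) (entrywise_mult (J - I - A) (mult_mat V A A))
      - scale_mat (real q) (J - I - A)"
  proof (intro ext)
    fix x y
    have frac: "4 / d * (1 * (e / 4 * d)) = e" if "d \<noteq> 0" for d e :: real using that by simp
    let ?N = "J x y - I x y - A x y" and ?W = "\<Sum>z\<in>V. A x z * A z y"
    have q: "real q + 1 \<noteq> 0" "real q - 1 \<noteq> 0" using cards by auto
    have "P x y = I x y + 4 / ((real q + 1) * (real q - 1)) * (?N * ?W) - real q * ?N"
    proof (cases "x \<in> V \<and> y \<in> V")
      case xy: True
      then have J: "J x y = 1" by (simp add: ones_mat_def)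
      show ?thesis
      proof (cases "c x = c y")
        case same: True
        then have QS: "Q x y = 1" "S x y = 0" using xy by (auto simp: Q_def S_def)
        consider "I x y = 1" "P x y = 1" | "I x y = 0" "P x y = 1" | "I x y = 0" "P x y = 0"
          using xy same by (cases "x = y"; cases "r x = r y") (auto simp: P_def id_mat_def)
        then show ?thesis
        proof cases
          case 2
          have N: "?N = 1" by (simp add: adj_mat_eq J QS 2)
          have W: "?W = (real q + 1) / 4 * ((real q + 1) * (real q - 1))"
            unfolding adj_mat_square J QS 2 by (simp add: power2_eq_square algebra_simps)
          show ?thesis unfolding N W unfolding 2 by (subst frac) (use q in simp_all)
        qed (simp_all add: adj_mat_eq J QS)
      next
        case False
        then have PQI: "P x y = 0" "Q x y = 0" "I x y = 0" by (auto simp: P_def Q_def id_mat_def)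
        have "h (m x y) (u x) = 1 \<or> h (m x y) (u x) = - 1" "h (m x y) (u y) = 1 \<or> h (m x y) (u y) = - 1"
          using xy False by (simp_all add: m_mem V_mem h_cases)
        then consider "S x y = 1" | "S x y = - 1" using xy False by (auto simp: S_def)
        then show ?thesis
        proof cases
          case 2
          have N: "?N = 1" by (simp add: adj_mat_eq J PQI 2)
          have W: "?W = (real q + 1) / 4 * (real q * (real q - 1))"
            unfolding adj_mat_square J PQI 2 by (simp add: power2_eq_square algebra_simps)
          show ?thesis unfolding N W unfolding PQI using q by simp
        qed (simp add: adj_mat_eq J PQI)
      qed
    qed (auto simp: P_def id_mat_def ones_mat_def adj_mat_def G_def)
    then show "P x y = (I + scale_mat (4 / ((real q + 1) * (real q - 1))) (entrywise_mult (J - I - A) (mult_mat V A A))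
      - scale_mat (real q) (J - I - A)) x y"
      by (simp add: scale_mat_def entrywise_mult_def mult_mat_def)
  qed
  also have "\<dots> \<in> ?C" by (intro closed I J A)
  finally have P: "P \<in> ?C" .
  \<comment> \<open>Multiplying by \<open>P\<close> annihilates the unknown \<open>S\<close> in
    \<open>A\<close>, so the equation can be solved for \<open>Q\<close>.\<close>
  have "(\<Sum>z\<in>V. A x z * P z y) = (real q + 1) * (Q x y - 2 * P x y + J x y) / 2" for x y
    unfolding sum_adj_mat products_P products_Q products_J products_S by (simp add: algebra_simps)
  then have "Q = scale_mat (2 / (real q + 1)) (mult_mat V A P) + scale_mat 2 P - J"
    by (simp add: fun_eq_iff scale_mat_def mult_mat_def field_simps)
  also have "\<dots> \<in> ?C" by (intro closed A P J)
  finally have Q: "Q \<in> ?C" .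
  have "S = scale_mat 2 A - Q + scale_mat 2 P - J"
    by (simp add: fun_eq_iff scale_mat_def adj_mat_eq field_simps)
  also have "\<dots> \<in> ?C" by (intro closed A P J Q)
  finally have "S \<in> ?C" .
  with I P Q J sub show "rmat.span B \<subseteq> ?C" by (intro rmat.span_minimal) auto
qed

text \<open>In the order \<open>S\<close>, \<open>I\<close>, \<open>P\<close>, \<open>Q\<close>,
  each matrix has two different entries at positions where all later matrices, including
  \<open>J\<close>, do not vary; finally \<open>J\<close> is nonzero.\<close>

lemma dim_span_B: "rmat.dim (rmat.span B) = 5"
proof -
  obtain w where w: "w \<in> U" using not_empty by blast
  obtain w' where w': "w' \<in> U" "w' \<noteq> w" by (rule card_gt_1_obtain_other[OF card_gt_1(3)])
  obtain s where s: "s \<in> F" using not_empty by blast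
  obtain s' where s': "s' \<in> F" "s' \<noteq> s" by (rule card_gt_1_obtain_other[OF card_gt_1(2)])
  obtain t where t: "t \<in> T" using not_empty by blast
  obtain t' where t': "t' \<in> T" "t' \<noteq> t" by (rule card_gt_1_obtain_other[OF card_gt_1(1)])
  obtain x where x: "x \<in> V" "c x = t" "r x = s" "u x = w" using V_ex[OF t s w] by blast
  obtain x1 where x1: "x1 \<in> V" "c x1 = t" "r x1 = s" "u x1 = w'" using V_ex[OF t s w'(1)] by blast
  obtain x2 where x2: "x2 \<in> V" "c x2 = t" "r x2 = s'" "u x2 = w" using V_ex[OF t s'(1) w] by blast
  let ?k = "sl t s t' s"
  have k: "?k \<in> F" using t t' s by (intro sl_mem) auto
  \<comment> \<open>A row of signs with sum zero is not constant. This provides two vertices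
    \<open>y\<close> and \<open>y'\<close> over one point that \<open>S\<close> separates in row
    \<open>x\<close>.\<close>
  have "\<exists>v\<in>U. h ?k v \<noteq> h ?k w"
  proof (rule ccontr)
    assume "\<not> (\<exists>v\<in>U. h ?k v \<noteq> h ?k w)"
    then have "(\<Sum>v\<in>U. h ?k v) = (\<Sum>v\<in>U. h ?k w)" by (intro sum.cong) auto
    then have "h ?k w = 0" using h_sum[OF k] cards by simp
    then show False using h_square[OF k w] by simp
  qed
  then obtain v where v: "v \<in> U" "h ?k v \<noteq> h ?k w" by blast
  obtain y where y: "y \<in> V" "c y = t'" "r y = s" "u y = w" using V_ex[OF t'(1) s w] by blast
  obtain y' where y': "y' \<in> V" "c y' = t'" "r y' = s" "u y' = v" using V_ex[OF t'(1) s v(1)] by blast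
  have neq: "x \<noteq> x1" "x \<noteq> x2" "x \<noteq> y" "x \<noteq> y'" using x x1 x2 y y' w' s' t' by auto
  note coords = x x1 x2 y y' t' t'(2)[symmetric] s' s'(2)[symmetric] neq
    P_def Q_def id_mat_def ones_mat_def
  have S: "S \<notin> rmat.span {I, P, Q, J}"
  proof (rule not_in_span_if_separated[of _ x y x y'])
    have "h ?k w \<noteq> 0" using h_square[OF k w] by auto
    then show "S x y \<noteq> S x y'" using v t' by (simp add: S_def m_def x y y')
  qed (auto simp: coords)
  have I: "I \<notin> rmat.span {P, Q, J}"
    by (rule not_in_span_if_separated[of _ x x x x1]) (auto simp: coords)
  have P: "P \<notin> rmat.span {Q, J}"
    by (rule not_in_span_if_separated[of _ x x x x2]) (auto simp: coords)
  have Q: "Q \<notin> rmat.span {J}"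
    by (rule not_in_span_if_separated[of _ x x x y]) (auto simp: coords)
  have J: "J \<notin> rmat.span {}"
    using x by (auto simp: fun_eq_iff ones_mat_def)
  have notin: "S \<notin> {I, P, Q, J}" "I \<notin> {P, Q, J}" "P \<notin> {Q, J}" "Q \<notin> {J}"
    by (rule contrapos_nn[OF S rmat.span_base] contrapos_nn[OF I rmat.span_base]
        contrapos_nn[OF P rmat.span_base] contrapos_nn[OF Q rmat.span_base], assumption)+
  have "rmat.independent B"
    by (intro rmat.independent_insertI S I P Q J rmat.independent_empty)
  moreover have "card B = 5" using notin by simp
  ultimately show ?thesis using rmat.dim_span_eq_card_independent[of B] by simp
qed

lemma coherent_rank_G: "coherent_rank G = 5"
  by (simp only: coherent_rank_def coherent_closure_G dim_span_B)

end

section \<open>Instantiation over a field of order \<open>q\<close>\<close>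

theorem theorem1p1:
  fixes q :: nat
  assumes "primepow q" and "q \<ge> 7" and "q mod 4 = 3"
  shows "\<exists>G :: nat pair_pre_digraph.
           neumaier_graph G
             ((q + 1) * q * (q - 2))
             ((q + 1)\<^sup>2 * (q - 2) div 2)
             ((q + 1) * (q\<^sup>2 + q - 8) div 4)
             ((q - 1)\<^sup>2 div 2)
             (q * (q - 2)) \<and>
           coherent_rank G = 5"
proof -
  obtain R :: "((int list \<times> nat) multiset \<Rightarrow> int) ring"
    where R: "field R" "finite (carrier R)" "card (carrier R) = q"
    using exists_finite_field[OF assms(1)] by blast
  interpret R: paley_field R
    using R assms(3) by (intro paley_field.intro paley_field_axioms.intro) simp_all
  obtain T where T: "T \<subseteq> carrier R" "card T = q - 2" "finite T"
    using obtain_subset_with_card_n[of "q - 2" "carrier R"] R(3) by auto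
  let ?X = "T \<times> carrier R \<times> R.paley_points"
  have "finite ?X" using R(2) T(3) R.card_paley_points(1) by simp
  \<comment> \<open>Numbering the triples makes the vertices natural numbers.\<close>
  then obtain f where f: "bij_betw f {0..<card ?X} ?X"
    using ex_bij_betw_nat_finite by blast
  interpret slope_graph "{0..<card ?X}" "\<lambda>n. fst (f n)" "\<lambda>n. fst (snd (f n))"
    "\<lambda>n. snd (snd (f n))" T "carrier R" R.paley_points R.slope R.paley_row q
  proof unfold_locales
    show "bij_betw (\<lambda>n. (fst (f n), fst (snd (f n)), snd (snd (f n)))) {0..<card ?X} ?X"
      using f by simp
    show "card R.paley_points = q + 1" using R.card_paley_points(2) R(3) by simp
    fix i j a assume "i \<in> T" "j \<in> T" "i \<noteq> j" "a \<in> carrier R"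
    then show "bij_betw (R.slope i a j) (carrier R) (carrier R)"
      using T(1) by (intro R.bij_betw_slope) auto
    fix b assume "b \<in> carrier R"
    then show "R.slope i a j b = R.slope j b i a"
      using T(1) \<open>i \<in> T\<close> \<open>j \<in> T\<close> \<open>i \<noteq> j\<close> \<open>a \<in> carrier R\<close> by (intro R.slope_sym) auto
    fix l d assume "l \<in> T" "l \<noteq> i" "l \<noteq> j" "d \<in> carrier R"
    then show "(R.slope i a l d = R.slope j b l d) = (R.slope i a l d = R.slope i a j b)"
      using T(1) \<open>i \<in> T\<close> \<open>j \<in> T\<close> \<open>i \<noteq> j\<close> \<open>a \<in> carrier R\<close> \<open>b \<in> carrier R\<close>
      by (intro R.slope_eq_slope_iff) auto
  qed (use R T assms(2) R.card_paley_points(1) R.paley_row_square R.sum_paley_row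
        R.sum_paley_rows R.sum_paley_columns in \<open>simp_all\<close>)
  show ?thesis using neumaier_G coherent_rank_G by blast
qed

end
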